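(* Let $\widehat{\mathrm{Lie}}_0=\widehat{W}_0=\mathbf{1}_{S_0}$ and $\widehat{\mathrm{Lie}}_1=\widehat W_1=0$. Then for all $n\ge1$, as (virtual) $S_n$-characters, $$\widehat{\mathrm{Lie}}_n=\widehat{\mathrm{Lie}}_{n-1}\big\uparrow_{S_{n-1}}^{S_n}+(-1)^n\epsilon_n,\qquad \widehat W_n=\widehat W_{n-1}\big\uparrow_{S_{n-1}}^{S_n}+(-1)^n\tau_n,$$ where $\epsilon_n$ is the sign character of $S_n$ and $\tau_n$ is the virtual character $\tau_n=\mathbf 1_{S_n}$ for $n\le 3$ and $\tau_n=\chi^{(3,1^{n-3})}-\chi^{(2,2,1^{n-4})}$ for $n\ge4$.
   Context: Let $C_n\subset S_n$ be generated by an $n$-cycle $c$, $\chi_\zeta$ a linear character of $C_n$ sending $c$ to a primitive $n$-th root of unity, and $\mathrm{Lie}_{(n)}=\chi_\zeta\uparrow_{C_n}^{S_n}$. Let $\mathrm{ch}$ be the Frobenius characteristic map from $S_n$-characters to symmetric functions, $\omega$ the involution with $\omega(h_n)=e_n$, and write $f[g]$ for plethysm. Put $\ell_n=\mathrm{ch}(\mathrm{Lie}_{(n)})$ and $\pi_n=\omega(\ell_n)$. For a partition $\lambda=1^{m_1}2^{m_2}\cdots$ of $n$ (with $m_j$ parts equal to $j$) define $S_n$-characters $\mathrm{Lie}_\lambda$, $W_\lambda$ by $\mathrm{ch}(\mathrm{Lie}_\lambda)=\prod_{j\ge1}h_{m_j}[\ell_j]$ and $\mathrm{ch}(W_\lambda)=\prod_{j\text{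 odd}}h_{m_j}[\pi_j]\prod_{j\text{ even}}e_{m_j}[\pi_j]$. The rank of $\lambda$ is $\mathrm{rank}(\lambda)=|\lambda|-\ell(\lambda)$ (number of parts $\ell(\lambda)$). For $n,i\ge0$ let $\widehat{\mathrm{Lie}}^i_n=\bigoplus_\lambda \mathrm{Lie}_\lambda$ and $\widehat W^i_n=\bigoplus_\lambda W_\lambda$, sums over partitions $\lambda$ of $n$ with no parts equal to $1$ and $\mathrm{rank}(\lambda)=i$ (the empty partition of $0$ has rank $0$, and $\mathrm{Lie}_\emptyset=W_\emptyset=\mathbf 1_{S_0}$). Set $\widehat{\mathrm{Lie}}_n=\bigoplus_i\widehat{\mathrm{Lie}}^i_n$, $\widehat W_n=\bigoplus_i\widehat W^i_n$. *)

theory Defs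
  imports Complex_Main "HOL-Library.Multiset" "HOL-Library.Poly_Mapping"
    "HOL-Combinatorics.Permutations"
begin

text \<open>Symmetric functions over the complex numbers are modelled as the polynomial ring
  in the power sums p_1, p_2, ...: an element is a finitely supported map from
  partitions (multisets of positive naturals) mu to the coefficient of p_mu.\<close>

type_synonym symf = "nat multiset \<Rightarrow>\<^sub>0 complex"

definition Sym :: "nat \<Rightarrow> (nat \<Rightarrow> nat) set" where
  "Sym n = {\<sigma>. \<sigma> permutes {..<n}}"

definition orbit_of :: "(nat \<Rightarrow> nat) \<Rightarrow> nat \<Rightarrow> nat set" where
  "orbit_of \<sigma> x = {(\<sigma> ^^ k) x | k. True}"

definition cycle_type :: "nat \<Rightarrow> (nat \<Rightarrow> nat) \<Rightarrow> nat multiset" where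
  "cycle_type n \<sigma> = image_mset card (mset_set (orbit_of \<sigma> ` {..<n}))"

definition ch :: "nat \<Rightarrow> ((nat \<Rightarrow> nat) \<Rightarrow> complex) \<Rightarrow> symf" where
  "ch n \<chi> = (\<Sum>\<sigma>\<in>Sym n. Poly_Mapping.single (cycle_type n \<sigma>) (\<chi> \<sigma> / of_nat (fact n)))"

definition zee :: "nat multiset \<Rightarrow> nat" where
  "zee \<mu> = (\<Prod>i\<in>set_mset \<mu>. i ^ count \<mu> i * fact (count \<mu> i))"

definition chinv :: "nat \<Rightarrow> symf \<Rightarrow> (nat \<Rightarrow> nat) \<Rightarrow> complex" where
  "chinv n f \<sigma> = of_nat (zee (cycle_type n \<sigma>)) * Poly_Mapping.lookup f (cycle_type n \<sigma>)"

text \<open>omega(p_mu) = (-1)^(|mu| - l(mu)) p_mu (the involution with omega(h_n) = e_n).\<close>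
definition omega :: "symf \<Rightarrow> symf" where
  "omega f = (\<Sum>\<mu>\<in>Poly_Mapping.keys f. Poly_Mapping.single \<mu> ((-1) ^ (sum_mset \<mu> - size \<mu>) * Poly_Mapping.lookup f \<mu>))"

definition hsym :: "nat \<Rightarrow> symf" where
  "hsym m = ch m (\<lambda>\<sigma>. 1)"

definition esym :: "nat \<Rightarrow> symf" where
  "esym m = ch m (\<lambda>\<sigma>. of_int (sign \<sigma>))"

definition pleth_p :: "nat \<Rightarrow> symf \<Rightarrow> symf" where
  "pleth_p k g = (\<Sum>\<nu>\<in>Poly_Mapping.keys g. Poly_Mapping.single (image_mset ((*) k) \<nu>) (Poly_Mapping.lookup g \<nu>))"

definition pleth :: "symf \<Rightarrow> symf \<Rightarrow> symf" where
  "pleth f g = (\<Sum>\<mu>\<in>Poly_Mapping.keys f. Poly_Mapping.single {#} (Poly_Mapping.lookup f \<mu>) *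
                   prod_mset (image_mset (\<lambda>i. pleth_p i g) \<mu>))"

definition primitive_root :: "complex \<Rightarrow> nat \<Rightarrow> bool" where
  "primitive_root z n \<longleftrightarrow> z ^ n = 1 \<and> (\<forall>k. 0 < k \<and> k < n \<longrightarrow> z ^ k \<noteq> 1)"

definition ncycle :: "nat \<Rightarrow> nat \<Rightarrow> nat" where
  "ncycle n i = (if i < n then Suc i mod n else i)"

text \<open>Lie_(n) = chi_zeta induced from C_n = <c> to S_n (zeta = image of c), via
  Ind chi(sigma) = (1/|C_n|) sum_{g in S_n} chi^0(g sigma g^-1).\<close>
definition Lie_cyc :: "complex \<Rightarrow> nat \<Rightarrow> (nat \<Rightarrow> nat) \<Rightarrow> complex" where
  "Lie_cyc z n \<sigma> = (1 / of_nat n) * (\<Sum>g\<in>Sym n. \<Sum>k<n.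
      if g \<circ> \<sigma> \<circ> inv g = (ncycle n ^^ k) then z ^ k else 0)"

definition indS :: "nat \<Rightarrow> ((nat \<Rightarrow> nat) \<Rightarrow> complex) \<Rightarrow> (nat \<Rightarrow> nat) \<Rightarrow> complex" where
  "indS n \<chi> \<sigma> = (1 / of_nat (fact (n - 1))) * (\<Sum>g\<in>Sym n.
      if (g \<circ> \<sigma> \<circ> inv g) permutes {..<n - 1} then \<chi> (g \<circ> \<sigma> \<circ> inv g) else 0)"

definition ell :: "(nat \<Rightarrow> complex) \<Rightarrow> nat \<Rightarrow> symf" where
  "ell \<zeta> n = ch n (Lie_cyc (\<zeta> n) n)"

definition piS :: "(nat \<Rightarrow> complex) \<Rightarrow> nat \<Rightarrow> symf" where
  "piS \<zeta> n = omega (ell \<zeta> n)"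

definition Lie_part :: "(nat \<Rightarrow> complex) \<Rightarrow> nat multiset \<Rightarrow> (nat \<Rightarrow> nat) \<Rightarrow> complex" where
  "Lie_part \<zeta> lam = chinv (sum_mset lam)
     (\<Prod>j\<in>set_mset lam. pleth (hsym (count lam j)) (ell \<zeta> j))"

definition W_part :: "(nat \<Rightarrow> complex) \<Rightarrow> nat multiset \<Rightarrow> (nat \<Rightarrow> nat) \<Rightarrow> complex" where
  "W_part \<zeta> lam = chinv (sum_mset lam)
     (\<Prod>j\<in>set_mset lam. if odd j then pleth (hsym (count lam j)) (piS \<zeta> j)
                                  else pleth (esym (count lam j)) (piS \<zeta> j))"

definition rank_part :: "nat multiset \<Rightarrow> nat" where
  "rank_part lam = sum_mset lam - size lam"

definition hat_parts :: "nat \<Rightarrow> nat \<Rightarrow> nat multiset set" where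
  "hat_parts n i = {lam. sum_mset lam = n \<and> (\<forall>j\<in>#lam. 2 \<le> j) \<and> rank_part lam = i}"

definition LieHat_i :: "(nat \<Rightarrow> complex) \<Rightarrow> nat \<Rightarrow> nat \<Rightarrow> (nat \<Rightarrow> nat) \<Rightarrow> complex" where
  "LieHat_i \<zeta> n i \<sigma> = (\<Sum>lam\<in>hat_parts n i. Lie_part \<zeta> lam \<sigma>)"

definition WHat_i :: "(nat \<Rightarrow> complex) \<Rightarrow> nat \<Rightarrow> nat \<Rightarrow> (nat \<Rightarrow> nat) \<Rightarrow> complex" where
  "WHat_i \<zeta> n i \<sigma> = (\<Sum>lam\<in>hat_parts n i. W_part \<zeta> lam \<sigma>)"

text \<open>Ranks of partitions of n are at most n.\<close>
definition LieHat :: "(nat \<Rightarrow> complex) \<Rightarrow> nat \<Rightarrow> (nat \<Rightarrow> nat) \<Rightarrow> complex" where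
  "LieHat \<zeta> n \<sigma> = (\<Sum>i\<le>n. LieHat_i \<zeta> n i \<sigma>)"

definition WHat :: "(nat \<Rightarrow> complex) \<Rightarrow> nat \<Rightarrow> (nat \<Rightarrow> nat) \<Rightarrow> complex" where
  "WHat \<zeta> n \<sigma> = (\<Sum>i\<le>n. WHat_i \<zeta> n i \<sigma>)"

text \<open>Schur functions via Jacobi--Trudi, s_lam = det(h_{lam_i - i + j}) (Leibniz expansion),
  for a partition given as a weakly decreasing list; irreducible characters
  chi^lam = ch^{-1}(s_lam).\<close>
definition hsym_int :: "int \<Rightarrow> symf" where
  "hsym_int k = (if k < 0 then 0 else hsym (nat k))"

definition schur :: "nat list \<Rightarrow> symf" where
  "schur lam = (\<Sum>\<pi>\<in>{\<pi>. \<pi> permutes {..<length lam}}.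
      Poly_Mapping.single {#} (of_int (sign \<pi>)) *
      (\<Prod>i<length lam. hsym_int (int (lam ! i) - int i + int (\<pi> i))))"

definition irr_char :: "nat list \<Rightarrow> (nat \<Rightarrow> nat) \<Rightarrow> complex" where
  "irr_char lam = chinv (sum_list lam) (schur lam)"

definition tau :: "nat \<Rightarrow> (nat \<Rightarrow> nat) \<Rightarrow> complex" where
  "tau n \<sigma> = (if n \<le> 3 then 1
     else irr_char ([3] @ replicate (n - 3) 1) \<sigma> - irr_char ([2, 2] @ replicate (n - 4) 1) \<sigma>)"

end

(*
  Expanding the induced character gives n l_n = sum over d | n of mu(d) p_d^(n/d). Work with power
  series in t and the logarithmic derivative t F'/F. Newton's identities show that for the product
  over j >= 2 of the series sum_m h_m[l_j] t^(jm), the coefficient of t^n in the logarithmic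
  derivative is p_1^n - p_n, since sum over d | m of mu(d) vanishes unless m = 1. Hence this product
  is E(-t) / (1 - p_1 t). For W the signs replace that divisor sum by the sum of
  (-1)^(m/d - 1) mu(d), which also has the value -2 at m = 2; this contributes a further factor
  1 + p_2 t^2. Inducing from S_(n-1) to S_n is multiplication by p_1, so multiplying by 1 - p_1 t
  leaves the correction terms (-1)^n e_n and (-1)^n (e_n + p_2 e_(n-2)), and the latter is
  ch(tau_n) by Jacobi-Trudi.

  The coefficient 1/z_mu of p_mu in h_n is the size of a conjugacy class over n!; it is computed
  by induction on n, inserting the new point into a cycle of a permutation of the others.
*)
theory Submission
  imports Defs
    "HOL-Combinatorics.Orbits"
    "HOL-Number_Theory.Cong"
    "HOL-Computational_Algebra.Formal_Power_Series"
    "Jordan_Normal_Form.Determinant"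
begin

text \<open>The product over all j >= 1 would be 1 / (1 - p_1 t); the term - p_n, hence the factor
  E(-t) = 1 / H(t), comes from leaving out j = 1, whose factor is H(t). Infinite products are
  avoided: up to degree N only the parts 2..N matter, so a finite product is compared with the
  closed form coefficient by coefficient. A series with constant term 1 is determined by its
  logarithmic derivative, since the recursion expresses n F_n by earlier coefficients and n cancels
  over the complex numbers. h_n, e_n and (-1)^n e_n all have coefficients w(mu) / z_mu with w
  multiplicative in the parts, so one family \<open>gsym\<close> and one proof of Newton's
  identities serve all three. Likewise the choice between h and e in W is a weight depending on j,
  and the total sign after omega depends on d only through (-1)^(m/d - 1). The value -2 at m = 2
  yields -2 (-p_2)^(n/2), the coefficient of t^n in the logarithmic derivative of 1 + p_2
  t^2.\<close>

unbundle no m_inv_syntax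

section \<open>Cycle types and class sizes\<close>

lemma Sym_permutation: "\<sigma> \<in> Sym n \<Longrightarrow> permutation \<sigma>"
  by (auto simp: Sym_def permutation_permutes)

lemma finite_Sym [simp]: "finite (Sym n)"
  by (simp add: Sym_def finite_permutations)

lemma card_Sym: "card (Sym n) = fact n"
  by (simp add: Sym_def card_permutations)

lemma orbit_of_eq_orbit: "permutation \<sigma> \<Longrightarrow> orbit_of \<sigma> x = orbit \<sigma> x"
  by (simp add: orbit_of_def orbit_altdef_permutation)

lemma cycle_type_orbit:
  assumes "permutation \<sigma>"
  shows "cycle_type n \<sigma> = image_mset card (mset_set (orbit \<sigma> ` {..<n}))"
  using assms by (simp add: cycle_type_def orbit_of_eq_orbit cong: image_cong)

lemma orbit_eq_of_mem:
  assumes "permutation \<sigma>" "y \<in> orbit \<sigma> x"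
  shows "orbit \<sigma> y = orbit \<sigma> x"
  using cyclic_on_orbit'[OF assms(1)] assms(2) by (rule orbit_cyclic_eq3)

text \<open>A cycle of length k is met once for each of its k points. With f = 1 this gives the
  degree, with the indicator of 1 the fixed points; the insertion count for class sizes has the same
  shape.\<close>

lemma sum_orbit_card:
  fixes f :: "nat \<Rightarrow> 'a::comm_semiring_1"
  assumes "\<sigma> \<in> Sym n"
  shows "(\<Sum>b<n. f (card (orbit \<sigma> b))) = (\<Sum>k\<in>#cycle_type n \<sigma>. of_nat k * f k)"
proof -
  have p: "permutation \<sigma>" and perm: "\<sigma> permutes {..<n}"
    using assms by (auto simp: Sym_permutation Sym_def)
  have fib: "{b \<in> {..<n}. orbit \<sigma> b = C} = C" if C: "C \<in> orbit \<sigma> ` {..<n}" for C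
  proof -
    obtain a where a: "a < n" "C = orbit \<sigma> a" using C by blast
    have "C \<subseteq> {..<n}" using permutes_orbit_subset[OF perm] a by auto
    then show ?thesis
      using a orbit_eq_of_mem[OF p] permutation_self_in_orbit[OF p] by blast
  qed
  have "(\<Sum>b<n. f (card (orbit \<sigma> b))) =
      (\<Sum>C\<in>orbit \<sigma> ` {..<n}. \<Sum>b\<in>{b \<in> {..<n}. orbit \<sigma> b = C}. f (card (orbit \<sigma> b)))"
    by (rule sum.image_gen) simp
  also have "\<dots> = (\<Sum>C\<in>orbit \<sigma> ` {..<n}. of_nat (card C) * f (card C))"
  proof (rule sum.cong[OF refl])
    fix C assume C: "C \<in> orbit \<sigma> ` {..<n}"
    have "(\<Sum>b\<in>{b \<in> {..<n}. orbit \<sigma> b = C}. f (card (orbit \<sigma> b))) =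
        (\<Sum>b\<in>{b \<in> {..<n}. orbit \<sigma> b = C}. f (card C))"
      by (rule sum.cong) auto
    also have "\<dots> = of_nat (card C) * f (card C)"
      by (subst fib[OF C]) simp
    finally show "(\<Sum>b\<in>{b \<in> {..<n}. orbit \<sigma> b = C}. f (card (orbit \<sigma> b))) = of_nat (card C) * f (card C)" .
  qed
  also have "\<dots> = (\<Sum>k\<in>#cycle_type n \<sigma>. of_nat k * f k)"
    by (simp add: cycle_type_orbit[OF p] sum_unfold_sum_mset multiset.map_comp o_def)
  finally show ?thesis .
qed

lemma sum_cycle_type:
  assumes "\<sigma> \<in> Sym n"
  shows "sum_mset (cycle_type n \<sigma>) = n"
  using sum_orbit_card[OF assms, of "\<lambda>_. 1 :: nat"] by simp

lemma sum_mset_delta_count: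
  "(\<Sum>x\<in>#M. if x = a then (f x :: 'a::comm_semiring_1) else 0) = of_nat (count M a) * f a"
  by (induction M) (auto simp: algebra_simps)

lemma card_fixpoints:
  assumes "\<sigma> \<in> Sym n"
  shows "card {b. b < n \<and> \<sigma> b = b} = count (cycle_type n \<sigma>) 1"
proof -
  have p: "permutation \<sigma>" using assms by (rule Sym_permutation)
  have iff: "\<sigma> b = b \<longleftrightarrow> card (orbit \<sigma> b) = 1" for b
    by (metis orbit_eq_singleton_iff card_1_singletonE is_singletonI is_singleton_altdef
        permutation_self_in_orbit[OF p] singletonD)
  have "card {b. b < n \<and> \<sigma> b = b} = (\<Sum>b<n. if card (orbit \<sigma> b) = 1 then 1 else 0)"
    unfolding iff by (simp add: sum.If_cases Int_def)
  also have "\<dots> = (\<Sum>k\<in>#cycle_type n \<sigma>. k * (if k = 1 then 1 else 0))"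
    using sum_orbit_card[OF assms, of "\<lambda>k. if k = 1 then 1 else 0 :: nat"] by simp
  also have "\<dots> = (\<Sum>k\<in>#cycle_type n \<sigma>. if k = 1 then k else 0)"
    by (rule arg_cong[where f = sum_mset], rule image_mset_cong) auto
  finally show ?thesis by (simp only: sum_mset_delta_count of_nat_id mult_1_right)
qed

lemma cycle_type_pos:
  assumes "\<sigma> \<in> Sym n" "k \<in># cycle_type n \<sigma>"
  shows "k > 0"
proof -
  have p: "permutation \<sigma>" using assms(1) by (rule Sym_permutation)
  have "finite (orbit \<sigma> x)" for x
    by (rule finite_orbit) (rule permutation_self_in_orbit[OF p])
  then show ?thesis
    using assms(2) orbit_nonempty[of \<sigma>] by (auto simp: cycle_type_orbit[OF p] card_gt_0_iff)
qed

lemma cycle_type_fix: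
  assumes "q \<in> Sym n"
  shows "cycle_type (Suc n) q = add_mset 1 (cycle_type n q)"
proof -
  have p: "permutation q" and perm: "q permutes {..<n}"
    using assms by (auto simp: Sym_permutation Sym_def)
  have o: "orbit q n = {n}"
    unfolding orbit_eq_singleton_iff using permutes_not_in[OF perm] by simp
  have "{n} \<notin> orbit q ` {..<n}"
    using permutes_orbit_subset[OF perm] by (metis imageE insert_subset lessThan_iff less_irrefl)
  then show ?thesis
    by (simp add: cycle_type_orbit[OF p] lessThan_Suc o)
qed

text \<open>The transposition redirects the arrow into b: the preimage of b goes to n and n goes to
  b. So n is inserted just before b, and only the cycle of b changes.\<close>

lemma cycle_type_insert:
  assumes q: "q \<in> Sym n" and b: "b < n"
  defines "k \<equiv> card (orbit q b)"
  shows "cycle_type (Suc n) (Transposition.transpose n b \<circ> q) = add_mset (Suc k) (cycle_type n q - {#k#})"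
    and "k \<in># cycle_type n q"
proof -
  have p: "permutation q" and perm: "q permutes {..<n}"
    using q by (auto simp: Sym_permutation Sym_def)
  define s where "s = Transposition.transpose n b \<circ> q"
  have sperm: "s permutes {..<Suc n}"
    unfolding s_def
    by (intro permutes_compose permutes_swap_id permutes_subset[OF perm]) (use b in auto)
  then have sp: "permutation s" by (auto simp: permutation_permutes)
  have qn: "q n = n" using permutes_not_in[OF perm] by simp
  have sn: "s n = b" by (simp add: s_def qn)
  have qlt: "x < n \<Longrightarrow> q x < n" for x using permutes_in_image[OF perm, of x] by simp
  have s_b: "s x = n" if "q x = b" for x using that by (simp add: s_def)
  have s_other: "s x = q x" if "x < n" "q x \<noteq> b" for x
    using qlt[OF that(1)] that(2) by (simp add: s_def transpose_def)
  have sub: "orbit q x \<subseteq> {..<n}" if "x < n" for x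
    using permutes_orbit_subset[OF perm] that by simp
  have other: "orbit s x = orbit q x" if x: "x < n" "b \<notin> orbit q x" for x
  proof (rule orbit_cong)
    show "x \<in> orbit q x" by (rule permutation_self_in_orbit[OF p])
    fix y assume y: "y \<in> orbit q x"
    then have "q y \<in> orbit q x" by (rule orbit.step)
    then show "s y = q y" using x y sub[OF x(1)] by (intro s_other) auto
  qed
  have nb: "orbit s b = insert n (orbit q b)"
  proof (intro equalityI subsetI)
    fix y assume "y \<in> orbit s b"
    then show "y \<in> insert n (orbit q b)"
    proof induction
      case base
      show ?case using b s_other[of b] s_b[of b] by (cases "q b = b") (auto intro: orbit.base)
    next
      case (step y)
      then consider "y = n" | "y \<in> orbit q b" by auto
      then show ?case
      proof cases
        case 1 then show ?thesis using sn permutation_self_in_orbit[OF p] by auto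
      next
        case 2
        then have "y < n" using sub[OF b] by auto
        then show ?thesis using 2 s_other[of y] s_b[of y]
          by (cases "q y = b") (auto intro: orbit.step)
      qed
    qed
  next
    have in1: "y \<in> orbit s b" if "y \<in> orbit q b" for y
      using that
    proof induction
      case base
      show ?case
        using b s_other[of b] permutation_self_in_orbit[OF sp, of b] orbit.base[of s b]
        by (cases "q b = b") auto
    next
      case (step y)
      then have "y < n" using sub[OF b] by auto
      then show ?case
        using step s_other[of y] permutation_self_in_orbit[OF sp, of b] orbit.step[of y s b]
        by (cases "q y = b") auto
    qed
    have "b \<in> orbit s n" using orbit.base[of s n] sn by simp
    then have "orbit s b = orbit s n" by (rule orbit_eq_of_mem[OF sp])
    then have "n \<in> orbit s b" using permutation_self_in_orbit[OF sp] by simp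
    then show "y \<in> insert n (orbit q b) \<Longrightarrow> y \<in> orbit s b" for y using in1 by auto
  qed
  have nn: "orbit s n = insert n (orbit q b)"
    using nb orbit_eq_of_mem[OF sp, of n b] by simp
  let ?O = "orbit q ` {..<n}" and ?B = "orbit q b"
  have img: "orbit s ` {..<Suc n} = insert (insert n ?B) (?O - {?B})"
  proof (intro equalityI subsetI)
    fix C assume "C \<in> orbit s ` {..<Suc n}"
    then obtain x where x: "x < Suc n" "C = orbit s x" by auto
    show "C \<in> insert (insert n ?B) (?O - {?B})"
    proof (cases "x = n \<or> b \<in> orbit q x")
      case True
      then consider "x = n" | "x \<noteq> n" "b \<in> orbit q x" by auto
      then show ?thesis
      proof cases
        case 1 then show ?thesis using x nn by simp
      next
        case 2
        then have "x \<in> orbit q b"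
          using orbit_eq_of_mem[OF p, of b x] permutation_self_in_orbit[OF p, of x] by simp
        then have "x \<in> orbit s b" by (simp add: nb)
        then have "orbit s x = orbit s b" by (rule orbit_eq_of_mem[OF sp])
        then show ?thesis using x nb by simp
      qed
    next
      case False
      then have "C = orbit q x" "x < n" using x other[of x] by auto
      moreover have "orbit q x \<noteq> ?B" using False permutation_self_in_orbit[OF p, of b] by auto
      ultimately show ?thesis by auto
    qed
  next
    fix C assume "C \<in> insert (insert n ?B) (?O - {?B})"
    then consider "C = insert n ?B" | x where "x < n" "C = orbit q x" "orbit q x \<noteq> ?B" by auto
    then show "C \<in> orbit s ` {..<Suc n}"
    proof cases
      case 1 then show ?thesis using nn by auto
    next
      case 2
      then have "b \<notin> orbit q x" using orbit_eq_of_mem[OF p, of b x] by auto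
      then show ?thesis using 2 other[of x] by auto
    qed
  qed
  have notin: "insert n ?B \<notin> ?O - {?B}"
    using sub by auto
  have finB: "finite ?B" using sub[OF b] by (rule finite_subset) simp
  have nB: "n \<notin> ?B" using sub[OF b] by auto
  have BO: "?B \<in> ?O" using b by simp
  have "cycle_type (Suc n) s = add_mset (card (insert n ?B)) (image_mset card (mset_set (?O - {?B})))"
    unfolding cycle_type_orbit[OF sp] img using notin by (subst mset_set.insert) auto
  also have "image_mset card (mset_set (?O - {?B})) = cycle_type n q - {#k#}"
    unfolding cycle_type_orbit[OF p] k_def using mset_set.remove[of ?O ?B] BO by simp
  also have "card (insert n ?B) = Suc k" using finB nB by (simp add: k_def)
  finally show "cycle_type (Suc n) (Transposition.transpose n b \<circ> q) = add_mset (Suc k) (cycle_type n q - {#k#})"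
    unfolding s_def .
  show "k \<in># cycle_type n q"
    unfolding cycle_type_orbit[OF p] k_def using BO by simp
qed

text \<open>The index b is the image of n, since q fixes n; for b = n the transposition is the
  identity, which gives the separate summand f q.\<close>

lemma sum_Sym_Suc:
  fixes f :: "(nat \<Rightarrow> nat) \<Rightarrow> 'a::comm_monoid_add"
  shows "(\<Sum>\<sigma>\<in>Sym (Suc n). f \<sigma>) = (\<Sum>q\<in>Sym n. f q + (\<Sum>b<n. f (Transposition.transpose n b \<circ> q)))"
proof -
  have "(\<Sum>\<sigma>\<in>Sym (Suc n). f \<sigma>) = (\<Sum>b\<in>insert n {..<n}. \<Sum>q\<in>Sym n. f (Transposition.transpose n b \<circ> q))"
    unfolding Sym_def lessThan_Suc by (rule sum_over_permutations_insert) auto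
  also have "\<dots> = (\<Sum>q\<in>Sym n. \<Sum>b\<in>insert n {..<n}. f (Transposition.transpose n b \<circ> q))"
    by (rule sum.swap)
  finally show ?thesis by simp
qed

lemma Sym_Suc_cases:
  assumes "\<sigma> \<in> Sym (Suc n)"
  obtains "\<sigma> \<in> Sym n" | q b where "q \<in> Sym n" "b < n" "\<sigma> = Transposition.transpose n b \<circ> q"
proof -
  have "\<sigma> \<in> {p. p permutes insert n {..<n}}" using assms by (simp add: Sym_def lessThan_Suc)
  then obtain b q where "b \<in> insert n {..<n}" "q permutes {..<n}" "\<sigma> = Transposition.transpose n b \<circ> q"
    unfolding permutes_insert by auto
  then show ?thesis using that by (auto simp: Sym_def)
qed

lemma size_cycle_type_le: "\<sigma> \<in> Sym n \<Longrightarrow> size (cycle_type n \<sigma>) \<le> n"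
proof -
  assume a: "\<sigma> \<in> Sym n"
  have "size M \<le> sum_mset M" if "\<forall>k\<in>#M. k > 0" for M :: "nat multiset"
    using that by (induction M) auto
  then show ?thesis using sum_cycle_type[OF a] cycle_type_pos[OF a] by metis
qed

text \<open>A new fixed point raises both the degree and the number of cycles; an insertion changes
  the sign and raises only the degree.\<close>

lemma sign_cycle_type:
  "\<sigma> \<in> Sym n \<Longrightarrow> sign \<sigma> = (-1) ^ (n - size (cycle_type n \<sigma>))"
proof (induction n arbitrary: \<sigma>)
  case 0
  then show ?case by (simp add: Sym_def)
next
  case (Suc n)
  from Suc.prems show ?case
  proof (cases rule: Sym_Suc_cases)
    case 1
    then show ?thesis by (simp add: Suc.IH cycle_type_fix)
  next
    case (2 q b)
    have "sign \<sigma> = - sign q"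
      using 2 by (simp add: sign_compose permutation_swap_id Sym_permutation sign_swap_id)
    moreover have "size (cycle_type (Suc n) \<sigma>) = size (cycle_type n q)"
      using cycle_type_insert[OF 2(1,2)] 2(3) by (simp add: size_Diff_singleton)
        (metis Suc_pred size_eq_0_iff_empty count_empty empty_iff gr0I set_mset_empty)
    ultimately show ?thesis
      using Suc.IH[OF 2(1)] size_cycle_type_le[OF 2(1)] by (simp add: Suc_diff_le)
  qed
qed

section \<open>Centraliser orders and sizes of conjugacy classes\<close>

lemma zee_add_mset: "zee (add_mset k \<nu>) = k * Suc (count \<nu> k) * zee \<nu>"
proof -
  let ?f = "\<lambda>M i. i ^ count M i * fact (count M i) :: nat"
  \<comment> \<open>Parts that do not occur contribute k^0 * 0! = 1, so both products can run over
    one index set.\<close>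
  have ext: "zee M = prod (?f M) A" if "finite A" "set_mset M \<subseteq> A" for M A
    unfolding zee_def using that by (intro prod.mono_neutral_left) (auto simp: not_in_iff)
  let ?A = "insert k (set_mset \<nu>)"
  have "zee (add_mset k \<nu>) = ?f (add_mset k \<nu>) k * prod (?f (add_mset k \<nu>)) (?A - {k})"
    by (subst ext[of ?A]) (auto simp: prod.remove[of ?A k] simp del: prod.insert prod.insert_remove)
  also have "prod (?f (add_mset k \<nu>)) (?A - {k}) = prod (?f \<nu>) (?A - {k})"
    by (rule prod.cong) auto
  also have "?f (add_mset k \<nu>) k = k * Suc (count \<nu> k) * ?f \<nu> k"
    by (simp add: algebra_simps)
  also have "k * Suc (count \<nu> k) * ?f \<nu> k * prod (?f \<nu>) (?A - {k}) = k * Suc (count \<nu> k) * zee \<nu>"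
    by (subst ext[of ?A \<nu>]) (auto simp: prod.remove[of ?A k] simp del: prod.insert prod.insert_remove)
  finally show ?thesis .
qed

lemma zee_pos: "0 \<notin># \<mu> \<Longrightarrow> zee \<mu> > 0"
  unfolding zee_def by (rule prod_pos) (auto intro!: gr0I)

lemma zee_remove: "k \<in># \<mu> \<Longrightarrow> zee \<mu> = k * count \<mu> k * zee (\<mu> - {#k#})"
  using zee_add_mset[of k "\<mu> - {#k#}"] by (simp add: Suc_pred' count_greater_zero_iff[symmetric] del: count_greater_zero_iff)

lemma sum_mset_image_eq_sum_count:
  "(\<Sum>x\<in>#M. f x :: 'a::comm_semiring_1) = (\<Sum>x\<in>set_mset M. of_nat (count M x) * f x)"
proof (induction M)
  case (add a M)
  show ?case
  proof (cases "a \<in># M")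
    case True
    then have "(\<Sum>x\<in>set_mset M - {a}. of_nat (count (add_mset a M) x) * f x)
        = (\<Sum>x\<in>set_mset M - {a}. of_nat (count M x) * f x)"
      by (intro sum.cong) auto
    then show ?thesis using True add
      by (simp add: insert_absorb sum.remove[of "set_mset M" a] algebra_simps)
  next
    case False
    then have "(\<Sum>x\<in>set_mset M. of_nat (count (add_mset a M) x) * f x)
        = (\<Sum>x\<in>set_mset M. of_nat (count M x) * f x)"
      by (intro sum.cong) auto
    then show ?thesis using False add by (simp add: not_in_iff)
  qed
qed simp

text \<open>Deleting the last point leaves mu without a 1, or \<open>nu k\<close> if it lay on a
  cycle of length k + 1. By induction these cases contribute count mu 1 and (k + 1) * count mu (k +
  1), each times n! / z_mu, and the multiplicities add up to the sum of mu.\<close>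

lemma card_cycle_type_class:
  assumes "sum_mset \<mu> = n" "0 \<notin># \<mu>"
  shows "of_nat (card {\<sigma>\<in>Sym n. cycle_type n \<sigma> = \<mu>}) = (fact n / of_nat (zee \<mu>) :: complex)"
  using assms
proof (induction n arbitrary: \<mu>)
  case 0
  then have "\<mu> = {#}" by (auto simp: multiset_eq_iff) (metis count_inI gr0I not_in_iff)
  then show ?case by (simp add: Sym_def cycle_type_def zee_def)
next
  case (Suc n)
  define N :: "nat multiset \<Rightarrow> complex" where "N \<nu> = of_nat (card {\<sigma>\<in>Sym n. cycle_type n \<sigma> = \<nu>})" for \<nu>
  have N: "N \<nu> = (\<Sum>q\<in>Sym n. of_bool (cycle_type n q = \<nu>))" for \<nu>
    by (simp add: N_def of_bool_def sum.If_cases Int_def)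
  define K where "K = {k. k > 0 \<and> Suc k \<in># \<mu>}"
  \<comment> \<open>The type from which lengthening a k-cycle produces mu. Its points on k-cycles
    number \<open>k * count (nu k) k\<close>, one for each possible insertion.\<close>
  define nu where "nu k = add_mset k (\<mu> - {#Suc k#})" for k
  have finK: "finite K"
    by (rule finite_subset[of _ "(\<lambda>x. x - 1) ` set_mset \<mu>"]) (force simp: K_def image_iff)+
  have z: "zee \<mu> > 0" using zee_pos Suc.prems by auto
  have inner: "(\<Sum>b<n. of_bool (cycle_type (Suc n) (Transposition.transpose n b \<circ> q) = \<mu>) :: complex)
      = (\<Sum>k\<in>K. of_bool (cycle_type n q = nu k) * of_nat (k * count (nu k) k))"
    if q: "q \<in> Sym n" for q
  proof -
    let ?M = "cycle_type n q"
    let ?f = "\<lambda>k. of_bool (add_mset (Suc k) (?M - {#k#}) = \<mu>) :: complex"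
    have eq: "add_mset (Suc k) (?M - {#k#}) = \<mu> \<longleftrightarrow> Suc k \<in># \<mu> \<and> ?M = nu k" if "k \<in># ?M" for k
      using that unfolding nu_def by (metis add_mset_remove_trivial insert_DiffM union_single_eq_member)
    have pos: "k > 0" if "k \<in># ?M" for k using cycle_type_pos[OF q that] .
    have "(\<Sum>b<n. of_bool (cycle_type (Suc n) (Transposition.transpose n b \<circ> q) = \<mu>) :: complex)
        = (\<Sum>b<n. ?f (card (orbit q b)))"
      by (rule sum.cong) (auto simp: cycle_type_insert[OF q])
    also have "\<dots> = (\<Sum>k\<in>#?M. of_nat k * ?f k)" by (rule sum_orbit_card[OF q])
    also have "\<dots> = (\<Sum>k\<in>set_mset ?M. of_nat (count ?M k) * (of_nat k * ?f k))"
      by (rule sum_mset_image_eq_sum_count)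
    also have "\<dots> = (\<Sum>k\<in>K. of_bool (?M = nu k) * of_nat (k * count (nu k) k))"
    proof (rule sum.mono_neutral_cong)
      show "finite K" by (rule finK)
      show "of_nat (count ?M k) * (of_nat k * ?f k) = 0" if "k \<in> set_mset ?M - K" for k
        using that pos[of k] eq[of k] by (auto simp: K_def)
      show "of_bool (?M = nu k) * of_nat (k * count (nu k) k) = (0::complex)" if "k \<in> K - set_mset ?M" for k
        using that by (auto simp: nu_def)
      show "of_nat (count ?M k) * (of_nat k * ?f k) = of_bool (?M = nu k) * of_nat (k * count (nu k) k)"
        if "k \<in> set_mset ?M \<inter> K" for k
        using that eq[of k] by (auto simp: K_def)
    qed simp
    finally show ?thesis .
  qed
  have "of_nat (card {\<sigma>\<in>Sym (Suc n). cycle_type (Suc n) \<sigma> = \<mu>})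
      = (\<Sum>\<sigma>\<in>Sym (Suc n). of_bool (cycle_type (Suc n) \<sigma> = \<mu>) :: complex)"
    by (simp add: of_bool_def sum.If_cases Int_def)
  also have "\<dots> = (\<Sum>q\<in>Sym n. of_bool (cycle_type (Suc n) q = \<mu>))
      + (\<Sum>q\<in>Sym n. \<Sum>k\<in>K. of_bool (cycle_type n q = nu k) * of_nat (k * count (nu k) k))"
    by (simp only: sum_Sym_Suc sum.distrib inner cong: sum.cong)
  also have "(\<Sum>q\<in>Sym n. of_bool (cycle_type (Suc n) q = \<mu>)) = (if 1 \<in># \<mu> then N (\<mu> - {#1#}) else 0)"
    unfolding N by (auto simp: cycle_type_fix intro!: sum.cong) (metis add_mset_remove_trivial insert_DiffM)+
  also have "(\<Sum>q\<in>Sym n. \<Sum>k\<in>K. of_bool (cycle_type n q = nu k) * of_nat (k * count (nu k) k))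
      = (\<Sum>k\<in>K. N (nu k) * of_nat (k * count (nu k) k))"
    unfolding N sum_distrib_right by (rule sum.swap)
  also have "(if 1 \<in># \<mu> then N (\<mu> - {#1#}) else 0) = fact n / of_nat (zee \<mu>) * of_nat (count \<mu> 1)"
  proof (cases "1 \<in># \<mu>")
    case True
    have s: "sum_mset (\<mu> - {#1#}) = n" "0 \<notin># \<mu> - {#1#}"
      using Suc.prems True by (auto simp: sum_mset_diff dest: in_diffD)
    then have "zee (\<mu> - {#1#}) > 0" by (intro zee_pos)
    then show ?thesis using True Suc.IH[OF s] zee_remove[OF True] by (simp add: N_def field_simps)
  qed (simp add: count_eq_zero_iff)
  also have "(\<Sum>k\<in>K. N (nu k) * of_nat (k * count (nu k) k))
      = (\<Sum>k\<in>K. fact n / of_nat (zee \<mu>) * of_nat (Suc k * count \<mu> (Suc k)))"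
  proof (rule sum.cong[OF refl])
    fix k assume k: "k \<in> K"
    then have k': "k > 0" "Suc k \<in># \<mu>" by (auto simp: K_def)
    have s: "sum_mset (nu k) = n" "0 \<notin># nu k"
      using Suc.prems k' sum_mset.remove[of "Suc k" \<mu>] by (auto simp: nu_def dest: in_diffD)
    have z1: "zee (\<mu> - {#Suc k#}) > 0" using Suc.prems by (intro zee_pos) (auto dest: in_diffD)
    have c: "count (nu k) k > 0" by (simp add: nu_def)
    \<comment> \<open>Both centraliser orders are compared with that of the common rest
      \<open>\<mu> - {#Suc k#}\<close>; the number of insertions then cancels.\<close>
    have "zee (nu k) = (k * count (nu k) k) * zee (\<mu> - {#Suc k#})"
      using zee_add_mset[of k "\<mu> - {#Suc k#}"] by (simp add: nu_def)
    moreover have "zee \<mu> = (Suc k * count \<mu> (Suc k)) * zee (\<mu> - {#Suc k#})"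
      using zee_remove[OF k'(2)] by simp
    moreover have "N (nu k) = fact n / of_nat (zee (nu k))" using Suc.IH[OF s] by (simp add: N_def)
    moreover have "k * count (nu k) k > 0" "Suc k * count \<mu> (Suc k) > 0" using k' c by auto
    ultimately show "N (nu k) * of_nat (k * count (nu k) k)
        = fact n / of_nat (zee \<mu>) * of_nat (Suc k * count \<mu> (Suc k))"
      using z1 by (simp only: of_nat_mult) (simp add: divide_simps del: of_nat_Suc)
  qed
  also have "fact n / of_nat (zee \<mu>) * of_nat (count \<mu> 1) + \<dots>
      = fact n / of_nat (zee \<mu>) * of_nat (count \<mu> 1 + (\<Sum>k\<in>K. Suc k * count \<mu> (Suc k)))"
    by (simp add: sum_distrib_left distrib_left)
  also have "count \<mu> 1 + (\<Sum>k\<in>K. Suc k * count \<mu> (Suc k)) = sum_mset \<mu>"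
  proof -
    have "(\<Sum>k\<in>K. Suc k * count \<mu> (Suc k)) = (\<Sum>j\<in>Suc ` K. count \<mu> j * j)"
      by (simp add: sum.reindex mult.commute)
    then have "count \<mu> 1 + (\<Sum>k\<in>K. Suc k * count \<mu> (Suc k)) = (\<Sum>j\<in>insert 1 (Suc ` K). count \<mu> j * j)"
      using finK by (subst sum.insert) (auto simp: K_def)
    also have "\<dots> = (\<Sum>j\<in>set_mset \<mu>. count \<mu> j * j)"
    proof (rule sum.mono_neutral_right)
      show "set_mset \<mu> \<subseteq> insert 1 (Suc ` K)"
      proof
        fix j assume "j \<in># \<mu>"
        then show "j \<in> insert 1 (Suc ` K)"
          using Suc.prems by (cases j; cases "j - 1") (auto simp: K_def)
      qed
    qed (use finK in \<open>auto simp: not_in_iff\<close>)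
    also have "\<dots> = sum_mset \<mu>" using sum_mset_image_eq_sum_count[of "\<lambda>x. x" \<mu>] by simp
    finally show ?thesis .
  qed
  finally show ?case using Suc.prems by simp
qed

section \<open>Newton's identities and plethysm\<close>

abbreviation cst :: "complex \<Rightarrow> symf" where
  "cst c \<equiv> Poly_Mapping.single {#} c"

definition pp :: "nat \<Rightarrow> symf" where
  "pp k = Poly_Mapping.single {#k#} 1"

lemma pp_power: "pp k ^ i = Poly_Mapping.single (replicate_mset i k) 1"
  by (induction i) (simp_all add: pp_def mult_single)

lemma symf_expansion: "f = (\<Sum>\<mu>\<in>Poly_Mapping.keys f. Poly_Mapping.single \<mu> (Poly_Mapping.lookup f \<mu>))"
  by (rule poly_mapping_eqI)
    (auto simp: lookup_sum lookup_single when_def in_keys_iff sum.delta)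

lemma symf_induct [case_names single add]:
  assumes "\<And>\<mu> c. P (Poly_Mapping.single \<mu> c)" "\<And>f g. P f \<Longrightarrow> P g \<Longrightarrow> P (f + g)"
  shows "P (f :: symf)"
proof -
  have P0: "P 0" using assms(1)[of "{#}" 0] by simp
  have "P (\<Sum>\<mu>\<in>A. Poly_Mapping.single \<mu> (Poly_Mapping.lookup f \<mu>))" if "finite A" for A
    using that by (induction A rule: finite_induct) (simp_all add: assms P0)
  then show ?thesis by (subst symf_expansion) simp
qed

lemma lookup_cst_mult [simp]: "Poly_Mapping.lookup (cst c * f) \<mu> = c * Poly_Mapping.lookup f \<mu>"
  by (induction f rule: symf_induct) (auto simp: mult_single lookup_single when_def distrib_left lookup_add)

lemma lookup_pp_mult:
  "Poly_Mapping.lookup (pp k * f) \<mu> = (if k \<in># \<mu> then Poly_Mapping.lookup f (\<mu> - {#k#}) else 0)"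
proof (induction f rule: symf_induct)
  case (single \<nu> c)
  have "add_mset k \<nu> = \<mu> \<longleftrightarrow> k \<in># \<mu> \<and> \<nu> = \<mu> - {#k#}" by auto
  then show ?case by (auto simp: pp_def mult_single lookup_single when_def)
qed (auto simp: distrib_left lookup_add)

lemma lookup_of_nat_mult [simp]:
  "Poly_Mapping.lookup (of_nat n * f :: symf) \<mu> = of_nat n * Poly_Mapping.lookup f \<mu>"
  using lookup_cst_mult[of "of_nat n" f \<mu>] by simp

text \<open>Coefficients are complex, so n cancels coefficientwise. This is what makes Newton-type
  recursions determine their solutions.\<close>

lemma of_nat_mult_cancel_symf:
  fixes f g :: symf
  assumes "of_nat n * f = of_nat n * g" "n > 0"
  shows "f = g"
proof (rule poly_mapping_eqI)
  fix \<mu>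
  have "Poly_Mapping.lookup (of_nat n * f) \<mu> = Poly_Mapping.lookup (of_nat n * g) \<mu>" using assms(1) by simp
  then show "Poly_Mapping.lookup f \<mu> = Poly_Mapping.lookup g \<mu>" using assms(2) by simp
qed

section \<open>Additivity of omega and of plethysm\<close>

lemma additive_of_nat_mult:
  fixes T :: "symf \<Rightarrow> symf"
  assumes "additive T"
  shows "T (of_nat n * f) = of_nat n * T f"
proof (induction n)
  case 0
  then show ?case using additive.zero[OF assms] by simp
next
  case (Suc n)
  then show ?case using additive.add[OF assms] by (simp add: distrib_right)
qed

text \<open>Cancellation can make the support of f + g smaller than the union of the supports; as T
  vanishes at coefficient 0, all sums can be taken over the union.\<close>

lemma additive_keys_sum:
  fixes T :: "nat multiset \<Rightarrow> complex \<Rightarrow> symf"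
  assumes "\<And>\<mu>. T \<mu> 0 = 0" "\<And>\<mu> a b. T \<mu> (a + b) = T \<mu> a + T \<mu> b"
  shows "additive (\<lambda>f. \<Sum>\<mu>\<in>Poly_Mapping.keys f. T \<mu> (Poly_Mapping.lookup f \<mu>))"
  by unfold_locales (rule setsum_keys_plus_distrib; simp add: assms)

lemma additive_omega: "additive omega"
  unfolding omega_def by (rule additive_keys_sum) (auto simp: distrib_left single_add)

lemma additive_pleth_p: "additive (pleth_p k)"
  unfolding pleth_p_def by (rule additive_keys_sum) (auto simp: single_add)

lemma additive_pleth: "additive (\<lambda>f. pleth f g)"
  unfolding pleth_def by (rule additive_keys_sum) (auto simp: single_add distrib_right)

lemma omega_single:
  "omega (Poly_Mapping.single \<mu> c) = Poly_Mapping.single \<mu> ((-1) ^ (sum_mset \<mu> - size \<mu>) * c)"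
  by (cases "c = 0") (auto simp: omega_def)

lemma pleth_p_single:
  "pleth_p k (Poly_Mapping.single \<mu> c) = Poly_Mapping.single (image_mset ((*) k) \<mu>) c"
  by (cases "c = 0") (auto simp: pleth_p_def)

lemma pleth_single:
  "pleth (Poly_Mapping.single \<mu> c) g = cst c * (\<Prod>i\<in>#\<mu>. pleth_p i g)"
  by (cases "c = 0") (auto simp: pleth_def)

lemma pleth_pp_mult: "pleth (pp k * f) g = pleth_p k g * pleth f g"
proof (induction f rule: symf_induct)
  case (single \<mu> c)
  show ?case by (simp add: pp_def mult_single pleth_single mult_ac)
qed (simp add: distrib_left additive.add[OF additive_pleth])

lemma pleth_cst_mult: "pleth (cst c * f) g = cst c * pleth f g"
proof (induction f rule: symf_induct)
  case (single \<mu> d)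
  have "cst (c * d) = cst c * cst d" "cst c * Poly_Mapping.single \<mu> d = Poly_Mapping.single \<mu> (c * d)"
    by (simp_all add: mult_single)
  then show ?case by (simp only: pleth_single mult.assoc)
qed (auto simp: distrib_left additive.add[OF additive_pleth])

section \<open>Multiplicative class functions and Newton's identities\<close>

lemma cycle_type_not_zero: "\<sigma> \<in> Sym n \<Longrightarrow> 0 \<notin># cycle_type n \<sigma>"
  using cycle_type_pos by blast

text \<open>The common generalisation of \<^term>\<open>hsym\<close> and \<^term>\<open>esym\<close>: the coefficient of \<open>p_\<mu>\<close>
  carries an additional weight multiplicative in the parts of \<open>\<mu>\<close>.\<close>
definition gsym :: "(nat \<Rightarrow> complex) \<Rightarrow> nat \<Rightarrow> symf" where
  "gsym \<epsilon> n = ch n (\<lambda>\<sigma>. \<Prod>k\<in>#cycle_type n \<sigma>. \<epsilon> k)"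

lemma lookup_ch_class:
  "Poly_Mapping.lookup (ch n (\<lambda>\<sigma>. \<phi> (cycle_type n \<sigma>))) \<mu>
    = (if sum_mset \<mu> = n \<and> 0 \<notin># \<mu> then \<phi> \<mu> / of_nat (zee \<mu>) else 0)"
proof -
  have "Poly_Mapping.lookup (ch n (\<lambda>\<sigma>. \<phi> (cycle_type n \<sigma>))) \<mu>
      = (\<Sum>\<sigma>\<in>Sym n. if cycle_type n \<sigma> = \<mu> then \<phi> \<mu> / fact n else 0)"
    unfolding ch_def lookup_sum by (rule sum.cong) (auto simp: lookup_single when_def)
  also have "\<dots> = of_nat (card {\<sigma>\<in>Sym n. cycle_type n \<sigma> = \<mu>}) * (\<phi> \<mu> / fact n)"
    by (simp add: sum.If_cases Int_def)
  finally have *: "Poly_Mapping.lookup (ch n (\<lambda>\<sigma>. \<phi> (cycle_type n \<sigma>))) \<mu>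
      = of_nat (card {\<sigma>\<in>Sym n. cycle_type n \<sigma> = \<mu>}) * (\<phi> \<mu> / fact n)" .
  show ?thesis
  proof (cases "sum_mset \<mu> = n \<and> 0 \<notin># \<mu>")
    case True
    then show ?thesis unfolding * by (simp add: card_cycle_type_class)
  next
    case False
    then have "{\<sigma>\<in>Sym n. cycle_type n \<sigma> = \<mu>} = {}"
      using sum_cycle_type cycle_type_not_zero by blast
    then show ?thesis unfolding * using False by (simp only: card.empty) simp
  qed
qed

lemma lookup_gsym:
  "Poly_Mapping.lookup (gsym \<epsilon> n) \<mu>
    = (if sum_mset \<mu> = n \<and> 0 \<notin># \<mu> then (\<Prod>k\<in>#\<mu>. \<epsilon> k) / of_nat (zee \<mu>) else 0)"
  unfolding gsym_def by (rule lookup_ch_class[of n "\<lambda>\<mu>. \<Prod>k\<in>#\<mu>. \<epsilon> k"])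

lemma hsym_gsym: "hsym n = gsym (\<lambda>_. 1) n"
  by (simp add: hsym_def gsym_def)

text \<open>The inequality is carried along because natural subtraction truncates: the exponents k -
  1 add up to the rank only when all parts are positive.\<close>

lemma prod_mset_sign:
  "0 \<notin># \<mu> \<Longrightarrow> size \<mu> \<le> sum_mset \<mu> \<and> (\<Prod>k\<in>#\<mu>. (-1) ^ (k - 1) :: complex) = (-1) ^ (sum_mset \<mu> - size \<mu>)"
proof (induction \<mu>)
  case (add k \<mu>)
  then have "k > 0" "size \<mu> \<le> sum_mset \<mu>" by (auto intro: gr0I)
  then have "sum_mset (add_mset k \<mu>) - size (add_mset k \<mu>) = (k - 1) + (sum_mset \<mu> - size \<mu>)"
    and "size (add_mset k \<mu>) \<le> sum_mset (add_mset k \<mu>)"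
    by simp_all
  moreover have "(\<Prod>j\<in>#\<mu>. (-1) ^ (j - 1) :: complex) = (-1) ^ (sum_mset \<mu> - size \<mu>)"
    using add by simp
  ultimately show ?case by (simp only: power_add image_mset_add_mset prod_mset.add_mset)
qed simp

lemma esym_gsym: "esym n = gsym (\<lambda>k. (-1) ^ (k - 1)) n"
  unfolding esym_def gsym_def ch_def
proof (rule sum.cong[OF refl])
  fix \<sigma> assume s: "\<sigma> \<in> Sym n"
  have "(of_int (sign \<sigma>) :: complex) = (-1) ^ (n - size (cycle_type n \<sigma>))"
    by (simp add: sign_cycle_type[OF s])
  also have "\<dots> = (\<Prod>k\<in>#cycle_type n \<sigma>. (-1) ^ (k - 1))"
    using prod_mset_sign[OF cycle_type_not_zero[OF s]] sum_cycle_type[OF s] by simp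
  finally show "Poly_Mapping.single (cycle_type n \<sigma>) (of_int (sign \<sigma>) / of_nat (fact n)) =
      Poly_Mapping.single (cycle_type n \<sigma>) ((\<Prod>k\<in>#cycle_type n \<sigma>. (- 1) ^ (k - 1)) / of_nat (fact n) :: complex)"
    by simp
qed

lemma gsym_0: "gsym \<epsilon> 0 = 1"
proof (rule poly_mapping_eqI)
  fix \<mu> :: "nat multiset"
  have "sum_mset \<mu> = 0 \<and> 0 \<notin># \<mu> \<longleftrightarrow> \<mu> = {#}"
    by (cases \<mu>) auto
  then show "Poly_Mapping.lookup (gsym \<epsilon> 0) \<mu> = Poly_Mapping.lookup 1 \<mu>"
    by (auto simp: lookup_gsym lookup_one when_def zee_def)
qed

text \<open>Removing one k from mu divides z_mu by k * count mu k and takes the factor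
  \<open>\<epsilon> k\<close> out of the weight. So at p_mu the k-th summand is k * count mu k times
  the coefficient of mu, and these multiplicities add up to n.\<close>

lemma gsym_newton:
  "of_nat n * gsym \<epsilon> n = (\<Sum>k=1..n. cst (\<epsilon> k) * pp k * gsym \<epsilon> (n - k))"
proof (rule poly_mapping_eqI)
  fix \<mu>
  let ?L = "Poly_Mapping.lookup (of_nat n * gsym \<epsilon> n) \<mu>"
  let ?R = "Poly_Mapping.lookup (\<Sum>k=1..n. cst (\<epsilon> k) * pp k * gsym \<epsilon> (n - k)) \<mu>"
  have R: "?R = (\<Sum>k=1..n. \<epsilon> k * (if k \<in># \<mu> then Poly_Mapping.lookup (gsym \<epsilon> (n - k)) (\<mu> - {#k#}) else 0))"
    by (simp only: lookup_sum mult.assoc lookup_cst_mult lookup_pp_mult)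
  show "?L = ?R"
  proof (cases "sum_mset \<mu> = n \<and> 0 \<notin># \<mu>")
    case True
    then have s: "sum_mset \<mu> = n" and nz: "0 \<notin># \<mu>" by auto
    have sub: "set_mset \<mu> \<subseteq> {1..n}"
    proof
      fix k assume k: "k \<in># \<mu>"
      then have "k \<noteq> 0" using nz by metis
      then show "k \<in> {1..n}" using sum_mset.remove[OF k] s by simp
    qed
    let ?w = "\<lambda>\<mu>. (\<Prod>k\<in>#\<mu>. \<epsilon> k) :: complex"
    have z: "zee \<mu> > 0" using nz by (rule zee_pos)
    have sm: "sum_mset \<mu> = (\<Sum>k\<in>set_mset \<mu>. count \<mu> k * k)"
      using sum_mset_image_eq_sum_count[of "\<lambda>x. x" \<mu>] by simp
    have alg: "e * (a / of_nat y) = of_nat c * (e * a / of_nat (c * y))" if "c > 0" for e a :: complex and c y :: nat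
      using that by simp
    have "?R = (\<Sum>k\<in>set_mset \<mu>. \<epsilon> k * Poly_Mapping.lookup (gsym \<epsilon> (n - k)) (\<mu> - {#k#}))"
      unfolding R using sub by (intro sum.mono_neutral_cong_right) auto
    also have "\<dots> = (\<Sum>k\<in>set_mset \<mu>. of_nat (count \<mu> k * k) * (?w \<mu> / of_nat (zee \<mu>)))"
    proof (rule sum.cong[OF refl])
      fix k assume k: "k \<in># \<mu>"
      have "sum_mset (\<mu> - {#k#}) = n - k" "0 \<notin># \<mu> - {#k#}"
        using s nz sum_mset.remove[OF k] by (auto dest: in_diffD)
      then have l: "Poly_Mapping.lookup (gsym \<epsilon> (n - k)) (\<mu> - {#k#}) = ?w (\<mu> - {#k#}) / of_nat (zee (\<mu> - {#k#}))"
        by (simp add: lookup_gsym)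
      have w: "?w \<mu> = \<epsilon> k * ?w (\<mu> - {#k#})"
        using k by (metis image_mset_add_mset insert_DiffM prod_mset.add_mset)
      have zr: "zee \<mu> = (count \<mu> k * k) * zee (\<mu> - {#k#})"
        using zee_remove[OF k] by (simp add: mult_ac)
      then have "count \<mu> k * k > 0" using z by (metis gr0I mult_0)
      then show "\<epsilon> k * Poly_Mapping.lookup (gsym \<epsilon> (n - k)) (\<mu> - {#k#})
          = of_nat (count \<mu> k * k) * (?w \<mu> / of_nat (zee \<mu>))"
        unfolding l w zr by (rule alg)
    qed
    also have "\<dots> = of_nat (sum_mset \<mu>) * (?w \<mu> / of_nat (zee \<mu>))"
      by (simp only: sm of_nat_sum sum_distrib_right)
    also have "\<dots> = ?L" using True by (simp add: lookup_gsym)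
    finally show ?thesis by simp
  next
    case False
    have "\<epsilon> k * (if k \<in># \<mu> then Poly_Mapping.lookup (gsym \<epsilon> (n - k)) (\<mu> - {#k#}) else 0) = 0"
      if k: "k \<in> {1..n}" for k
    proof (cases "k \<in># \<mu>")
      case True
      have "\<not> (sum_mset (\<mu> - {#k#}) = n - k \<and> 0 \<notin># \<mu> - {#k#})"
        using False k sum_mset.remove[OF True] by (auto simp: in_diff_count)
      then show ?thesis by (simp only: lookup_gsym if_False if_cancel mult_zero_right)
    qed simp
    then have "?R = 0" unfolding R by (intro sum.neutral) blast
    moreover have "?L = 0"
      using False by (simp only: lookup_gsym lookup_of_nat_mult if_False mult_zero_right)
    ultimately show ?thesis by simp
  qed
qed

lemma pleth_gsym_0: "pleth (gsym \<epsilon> 0) g = 1"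
  using pleth_single[of "{#}" 1 g] by (simp add: gsym_0)

lemma pleth_gsym_newton:
  "of_nat n * pleth (gsym \<epsilon> n) g = (\<Sum>k=1..n. cst (\<epsilon> k) * pleth_p k g * pleth (gsym \<epsilon> (n - k)) g)"
proof -
  have "of_nat n * pleth (gsym \<epsilon> n) g = pleth (of_nat n * gsym \<epsilon> n) g"
    using additive_of_nat_mult[OF additive_pleth] by simp
  also have "\<dots> = (\<Sum>k=1..n. pleth (cst (\<epsilon> k) * (pp k * gsym \<epsilon> (n - k))) g)"
    by (simp only: gsym_newton additive.sum[OF additive_pleth] mult.assoc)
  finally show ?thesis by (simp only: pleth_cst_mult pleth_pp_mult mult.assoc)
qed

section \<open>The power sum expansion of \<open>\<ell>_n\<close>\<close>

lemma cycle_type_conj: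
  assumes s: "\<sigma> \<in> Sym n" and g: "g \<in> Sym n"
  shows "cycle_type n (g \<circ> \<sigma> \<circ> inv g) = cycle_type n \<sigma>"
proof -
  have gp: "g permutes {..<n}" using g by (simp add: Sym_def)
  have inj: "inj g" using permutes_inj[OF gp] .
  have fp: "((g \<circ> \<sigma> \<circ> inv g) ^^ k) (g x) = g ((\<sigma> ^^ k) x)" for k x
    by (induction k) (simp_all add: inj)
  have "orbit_of (g \<circ> \<sigma> \<circ> inv g) (g x) = g ` orbit_of \<sigma> x" for x
    by (auto simp: orbit_of_def fp)
  then have "orbit_of (g \<circ> \<sigma> \<circ> inv g) ` g ` {..<n} = image g ` orbit_of \<sigma> ` {..<n}"
    by (simp add: image_image)
  then have *: "orbit_of (g \<circ> \<sigma> \<circ> inv g) ` {..<n} = image g ` orbit_of \<sigma> ` {..<n}"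
    by (simp add: permutes_image[OF gp])
  have "inj_on (image g) A" for A
    using inj by (meson inj_image_eq_iff inj_onI)
  then have "mset_set (image g ` orbit_of \<sigma> ` {..<n}) = image_mset (image g) (mset_set (orbit_of \<sigma> ` {..<n}))"
    by (simp add: image_mset_mset_set)
  moreover have "card (g ` C) = card C" for C
    by (rule card_image) (rule inj_on_subset[OF inj], simp)
  ultimately show ?thesis
    unfolding cycle_type_def * by (simp add: multiset.map_comp o_def)
qed

lemma ncycle_funpow: "i < n \<Longrightarrow> (ncycle n ^^ k) i = (i + k) mod n"
proof (induction k)
  case (Suc k)
  then show ?case by (simp add: ncycle_def mod_Suc_eq)
qed simp

lemma ncycle_permutes: "ncycle n permutes {..<n}"
proof (rule bij_imp_permutes)
  show "bij_betw (ncycle n) {..<n} {..<n}"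
  proof (cases n)
    case (Suc m)
    have "i \<in> ncycle n ` {..<n}" if "i < n" for i
    proof (cases i)
      case 0
      then have "i = ncycle n m" using Suc by (simp add: ncycle_def)
      then show ?thesis using Suc by auto
    next
      case (Suc j)
      then have "i = ncycle n j" using that by (simp add: ncycle_def)
      then show ?thesis using Suc that by auto
    qed
    then have "ncycle n ` {..<n} = {..<n}"
      using Suc by (auto simp: ncycle_def)
    then show ?thesis by (simp add: bij_betw_def eq_card_imp_inj_on)
  qed (simp add: bij_betw_def)
qed (auto simp: ncycle_def)

lemma ncycle_funpow_Sym: "ncycle n ^^ k \<in> Sym n"
proof (induction k)
  case 0
  show ?case by (simp add: Sym_def permutes_id[unfolded id_def])
next
  case (Suc k)
  then show ?case by (simp only: funpow.simps Sym_def mem_Collect_eq permutes_compose ncycle_permutes)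
qed

text \<open>\<open>n div gcd k n\<close> is the order of k in Z/n, and the elements of order
  dividing d form the subgroup generated by n div d.\<close>

lemma dvd_div_gcd_iff:
  fixes n d k :: nat
  assumes n: "n > 0" and d: "d dvd n"
  shows "n div gcd k n dvd d \<longleftrightarrow> n div d dvd k"
proof -
  obtain e where e: "n = d * e" using d by auto
  have de: "d > 0" "e > 0" using n e by auto
  have g: "gcd k n > 0" using n by simp
  have "n div gcd k n dvd d \<longleftrightarrow> n dvd d * gcd k n"
  proof -
    have "n div gcd k n dvd d \<longleftrightarrow> n div gcd k n * gcd k n dvd d * gcd k n"
      using nat_mult_dvd_cancel1[OF g, of "n div gcd k n" d] by (simp only: mult.commute)
    also have "n div gcd k n * gcd k n = n" by simp
    finally show ?thesis .
  qed
  also have "\<dots> \<longleftrightarrow> e dvd gcd k n" using e de by simp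
  also have "\<dots> \<longleftrightarrow> e dvd k" using e by simp
  finally show ?thesis using e de by simp
qed

text \<open>The permutation is translation by k on Z/n; its orbits are the cosets of the subgroup
  generated by k.\<close>

lemma cycle_type_ncycle_funpow:
  assumes n: "n > 0"
  shows "cycle_type n (ncycle n ^^ k) = replicate_mset (gcd k n) (n div gcd k n)"
proof -
  let ?s = "ncycle n ^^ k" and ?r = "n div gcd k n"
  have s: "?s \<in> Sym n" by (rule ncycle_funpow_Sym)
  have r: "?r > 0" using n by (simp add: div_greater_zero_iff gcd_le2_nat)
  have card: "card (orbit ?s x) = ?r" if x: "x < n" for x
  proof -
    have f: "(?s ^^ i) x = (x + k * i) mod n" for i
      using ncycle_funpow[OF x] by (simp add: funpow_mult)
    have per: "(x + k * i) mod n = (x + k * j) mod n \<longleftrightarrow> [i = j] (mod ?r)" for i j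
    proof -
      have "(x + k * i) mod n = (x + k * j) mod n \<longleftrightarrow> [k * i = k * j] (mod n)"
        using cong_add_lcancel_nat[of x "k * i" "k * j" n] by (simp add: cong_def)
      also have "\<dots> \<longleftrightarrow> [i = j] (mod ?r)"
      proof -
        obtain a b where ab: "k = a * gcd k n" "n = b * gcd k n" "coprime a b"
          using n by (metis gcd_coprime_exists gcd_nat.eq_neutr_iff not_gr_zero)
        have g: "gcd k n > 0" using n by simp
        have cancel: "[u * h = v * h] (mod b * h) \<longleftrightarrow> [u = v] (mod b)" if "h > 0" for u v h :: nat
          using that by (simp add: cong_def mult_mod_left[symmetric])
        have "[k * i = k * j] (mod n) \<longleftrightarrow> [(a * i) * gcd k n = (a * j) * gcd k n] (mod b * gcd k n)"
          using ab by (metis mult.assoc mult.commute)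
        also have "\<dots> \<longleftrightarrow> [a * i = a * j] (mod b)"
          by (rule cancel[OF g])
        also have "\<dots> \<longleftrightarrow> [i = j] (mod b)" using ab(3) by (rule cong_mult_lcancel_nat)
        finally show ?thesis using ab g by (metis nonzero_mult_div_cancel_right neq0_conv)
      qed
      finally show ?thesis .
    qed
    have "orbit ?s x = (\<lambda>i. (x + k * i) mod n) ` {..<?r}"
    proof -
      have "orbit ?s x = range (\<lambda>i. (x + k * i) mod n)"
        by (simp add: orbit_altdef_permutation[OF Sym_permutation[OF s]] f full_SetCompr_eq)
      moreover have "(x + k * i) mod n \<in> (\<lambda>i. (x + k * i) mod n) ` {..<?r}" for i
        using per[of i "i mod ?r"] r by (intro image_eqI[of _ _ "i mod ?r"]) (auto simp: cong_def)
      ultimately show ?thesis by auto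
    qed
    moreover have "inj_on (\<lambda>i. (x + k * i) mod n) {..<?r}"
      by (rule inj_onI) (auto simp: per cong_def)
    ultimately show ?thesis by (simp add: card_image)
  qed
  have "\<forall>j\<in>#cycle_type n ?s. j = ?r"
    by (auto simp: cycle_type_orbit[OF Sym_permutation[OF s]] card)
  then have *: "cycle_type n ?s = replicate_mset (size (cycle_type n ?s)) ?r"
    by (metis set_mset_subset_singletonD subsetI singletonI)
  have "size (cycle_type n ?s) * ?r = n"
    using sum_cycle_type[OF s] by (subst (asm) *) simp
  moreover have "gcd k n * ?r = n" by simp
  ultimately have "size (cycle_type n ?s) * ?r = gcd k n * ?r" by (simp only:)
  then have "size (cycle_type n ?s) = gcd k n \<or> ?r = 0" by (simp only: mult_cancel2)
  then have "size (cycle_type n ?s) = gcd k n" using r by linarith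
  then show ?thesis using * by simp
qed

text \<open>Conjugation preserves cycle type, so every g in the induction formula contributes what
  the identity contributes. The sum over g cancels the n! in \<open>ch\<close>, and the average over
  the cyclic group remains.\<close>

lemma ell_eq_sum:
  assumes n: "n > 0"
  shows "of_nat n * ell \<zeta> n = (\<Sum>k<n. Poly_Mapping.single (cycle_type n (ncycle n ^^ k)) (\<zeta> n ^ k))"
proof (rule poly_mapping_eqI)
  fix \<mu>
  let ?c = "\<lambda>k. ncycle n ^^ k"
  let ?z = "\<zeta> n"
  have conj_iff: "g \<circ> \<sigma> \<circ> inv g = ?c k \<longleftrightarrow> \<sigma> = inv g \<circ> ?c k \<circ> g" if "g \<in> Sym n" for g \<sigma> k
  proof -
    have "g permutes {..<n}" using that by (simp add: Sym_def)
    from permutes_inv_o[OF this] show ?thesis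
      by (metis (no_types, opaque_lifting) comp_assoc comp_id id_comp)
  qed
  have inner: "(\<Sum>\<sigma>\<in>Sym n. of_bool (cycle_type n \<sigma> = \<mu>) * (if g \<circ> \<sigma> \<circ> inv g = ?c k then ?z ^ k else 0))
      = of_bool (cycle_type n (?c k) = \<mu>) * ?z ^ k" if g: "g \<in> Sym n" for g k
  proof -
    have gp: "g permutes {..<n}" using g by (simp add: Sym_def)
    have ig: "inv g \<in> Sym n" using permutes_inv[OF gp] by (simp add: Sym_def)
    let ?t = "inv g \<circ> ?c k \<circ> g"
    have t: "?t \<in> Sym n"
      using g ig ncycle_funpow_Sym[of k n] by (auto simp: Sym_def intro!: permutes_compose)
    have ct: "cycle_type n ?t = cycle_type n (?c k)"
      using cycle_type_conj[OF ncycle_funpow_Sym ig, of k] by (simp add: permutes_inv_inv[OF gp])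
    have "(\<Sum>\<sigma>\<in>Sym n. of_bool (cycle_type n \<sigma> = \<mu>) * (if g \<circ> \<sigma> \<circ> inv g = ?c k then ?z ^ k else 0))
        = (\<Sum>\<sigma>\<in>Sym n. if \<sigma> = ?t then of_bool (cycle_type n ?t = \<mu>) * ?z ^ k else 0)"
      by (rule sum.cong) (auto simp: conj_iff[OF g])
    also have "\<dots> = of_bool (cycle_type n (?c k) = \<mu>) * ?z ^ k"
      using t ct by (simp add: sum.delta')
    finally show ?thesis .
  qed
  have "Poly_Mapping.lookup (ell \<zeta> n) \<mu> = (\<Sum>\<sigma>\<in>Sym n. of_bool (cycle_type n \<sigma> = \<mu>) * (Lie_cyc ?z n \<sigma> / fact n))"
    unfolding ell_def ch_def lookup_sum by (rule sum.cong) (auto simp: lookup_single when_def)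
  also have "\<dots> = (\<Sum>\<sigma>\<in>Sym n. \<Sum>g\<in>Sym n. \<Sum>k<n. 1 / (of_nat n * fact n) *
      (of_bool (cycle_type n \<sigma> = \<mu>) * (if g \<circ> \<sigma> \<circ> inv g = ?c k then ?z ^ k else 0)))"
    unfolding Lie_cyc_def by (simp add: sum_distrib_left sum_divide_distrib mult_ac)
  also have "\<dots> = (\<Sum>g\<in>Sym n. \<Sum>\<sigma>\<in>Sym n. \<Sum>k<n. 1 / (of_nat n * fact n) *
      (of_bool (cycle_type n \<sigma> = \<mu>) * (if g \<circ> \<sigma> \<circ> inv g = ?c k then ?z ^ k else 0)))"
    by (rule sum.swap)
  also have "\<dots> = (\<Sum>g\<in>Sym n. \<Sum>k<n. 1 / (of_nat n * fact n) * (of_bool (cycle_type n (?c k) = \<mu>) * ?z ^ k))"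
  proof (rule sum.cong[OF refl])
    fix g assume g: "g \<in> Sym n"
    have "(\<Sum>\<sigma>\<in>Sym n. \<Sum>k<n. 1 / (of_nat n * fact n) *
        (of_bool (cycle_type n \<sigma> = \<mu>) * (if g \<circ> \<sigma> \<circ> inv g = ?c k then ?z ^ k else 0)))
      = (\<Sum>k<n. 1 / (of_nat n * fact n) * (\<Sum>\<sigma>\<in>Sym n.
        of_bool (cycle_type n \<sigma> = \<mu>) * (if g \<circ> \<sigma> \<circ> inv g = ?c k then ?z ^ k else 0)))"
      by (subst sum.swap) (simp only: sum_distrib_left)
    then show "(\<Sum>\<sigma>\<in>Sym n. \<Sum>k<n. 1 / (of_nat n * fact n) *
        (of_bool (cycle_type n \<sigma> = \<mu>) * (if g \<circ> \<sigma> \<circ> inv g = ?c k then ?z ^ k else 0)))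
      = (\<Sum>k<n. 1 / (of_nat n * fact n) * (of_bool (cycle_type n (?c k) = \<mu>) * ?z ^ k))"
      by (simp only: inner[OF g])
  qed
  also have "\<dots> = 1 / of_nat n * (\<Sum>k<n. of_bool (cycle_type n (?c k) = \<mu>) * ?z ^ k)"
  proof -
    have "1 / (of_nat n * fact n) * (of_nat (fact n) * X) = 1 / of_nat n * X" for X :: complex
      by simp
    then show ?thesis by (simp only: sum_distrib_left[symmetric] sum_constant card_Sym)
  qed
  also have "(\<Sum>k<n. of_bool (cycle_type n (?c k) = \<mu>) * ?z ^ k)
      = Poly_Mapping.lookup (\<Sum>k<n. Poly_Mapping.single (cycle_type n (?c k)) (?z ^ k)) \<mu>"
    unfolding lookup_sum by (rule sum.cong) (auto simp: lookup_single when_def)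
  finally show "Poly_Mapping.lookup (of_nat n * ell \<zeta> n) \<mu>
      = Poly_Mapping.lookup (\<Sum>k<n. Poly_Mapping.single (cycle_type n (?c k)) (?z ^ k)) \<mu>"
    using n by simp
qed

section \<open>Moebius inversion and sums of roots of unity\<close>

function moebius :: "nat \<Rightarrow> complex" where
  "moebius n = (if n = 1 then 1 else - (\<Sum>d\<in>{d. d dvd n \<and> d < n}. moebius d))"
  by auto
termination by (relation "measure id") auto

declare moebius.simps [simp del]

lemma sum_moebius:
  assumes "n > 0"
  shows "(\<Sum>d | d dvd n. moebius d) = of_bool (n = 1)"
proof -
  have "{d. d dvd n} = insert n {d. d dvd n \<and> d < n}"
    using assms by (auto dest: dvd_imp_le simp: le_neq_implies_less)
  moreover have "finite {d. d dvd n \<and> d < n}" by simp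
  ultimately show ?thesis
    using moebius.simps[of n] by (cases "n = 1") auto
qed

text \<open>The divisor sums form a triangular system. The assumption concerns divisors of a fixed n
  because the sums of roots of unity to be identified are defined relative to n.\<close>

lemma moebius_unique:
  fixes f :: "nat \<Rightarrow> complex"
  assumes "\<And>d. d dvd n \<Longrightarrow> (\<Sum>e | e dvd d. f e) = of_bool (d = 1)" and "n > 0"
  shows "d dvd n \<Longrightarrow> f d = moebius d"
proof (induction d rule: less_induct)
  case (less d)
  have d: "d > 0" using less.prems assms(2) by (auto intro: gr0I)
  have eq: "{e. e dvd d} = insert d {e. e dvd d \<and> e < d}"
    using d by (auto dest: dvd_imp_le simp: le_neq_implies_less)
  have "(\<Sum>e | e dvd d \<and> e < d. f e) = (\<Sum>e | e dvd d \<and> e < d. moebius e)"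
    using less by (intro sum.cong) (auto dest: dvd_trans)
  moreover have "(\<Sum>e | e dvd d. f e) = (\<Sum>e | e dvd d. moebius e)"
    using assms(1)[OF less.prems] sum_moebius[OF d] by simp
  ultimately show ?case unfolding eq by simp
qed

text \<open>Powers of the cycle are grouped by their order d. \<open>?S d\<close> is the sum of the
  primitive d-th roots of unity; over all divisors of d these sums give the sum of all d-th roots,
  which is 0 unless d = 1, so \<open>moebius_unique\<close> applies.\<close>

lemma ell_formula:
  assumes n: "n > 0" and z: "primitive_root (\<zeta> n) n"
  shows "of_nat n * ell \<zeta> n = (\<Sum>d | d dvd n. cst (moebius d) * pp d ^ (n div d))"
proof -
  let ?z = "\<zeta> n"
  let ?d = "\<lambda>k. n div gcd k n"
  let ?S = "\<lambda>d. \<Sum>k | k < n \<and> ?d k = d. ?z ^ k"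
  have dpos: "d > 0" if "d dvd n" for d using that n by (auto intro: gr0I)
  have fin: "finite {d. d dvd n}" using n by simp
  have S: "?S d = moebius d" if "d dvd n" for d
  proof (rule moebius_unique[OF _ n that])
    fix d assume d: "d dvd n"
    let ?w = "?z ^ (n div d)"
    have "(\<Sum>e | e dvd d. ?S e) = (\<Sum>k | k < n \<and> ?d k dvd d. ?z ^ k)"
    proof -
      have "(\<Sum>e\<in>{e. e dvd d}. \<Sum>k\<in>{k \<in> {k. k < n \<and> ?d k dvd d}. ?d k = e}. ?z ^ k)
          = (\<Sum>k | k < n \<and> ?d k dvd d. ?z ^ k)"
        using dpos[OF d] by (intro sum.group) auto
      moreover have "{k \<in> {k. k < n \<and> ?d k dvd d}. ?d k = e} = {k. k < n \<and> ?d k = e}" if "e dvd d" for e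
        using that by auto
      ultimately show ?thesis by simp
    qed
    also have "\<dots> = (\<Sum>i<d. ?w ^ i)"
    \<comment> \<open>By \<open>dvd_div_gcd_iff\<close> the admissible k are the multiples of n div
      d, so z^k runs through the powers of \<open>?w\<close>.\<close>
    proof (rule sum.reindex_bij_witness[of _ "\<lambda>i. n div d * i" "\<lambda>k. k div (n div d)"])
      have nd: "n div d > 0" "n = n div d * d"
        using n d dvd_imp_le[OF d n] dpos[OF d] by (auto simp: div_greater_zero_iff)
      fix k assume "k \<in> {k. k < n \<and> ?d k dvd d}"
      then have k: "k < n" "n div d dvd k" using dvd_div_gcd_iff[OF n d] by auto
      then show "n div d * (k div (n div d)) = k" "?w ^ (k div (n div d)) = ?z ^ k"
        by (simp_all flip: power_mult)
      show "k div (n div d) \<in> {..<d}" using k nd by (metis less_mult_imp_div_less lessThan_iff mult.commute)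
    next
      have nd: "n div d > 0" "n = n div d * d"
        using n d dvd_imp_le[OF d n] dpos[OF d] by (auto simp: div_greater_zero_iff)
      fix i assume "i \<in> {..<d}"
      then show "n div d * i div (n div d) = i" "n div d * i \<in> {k. k < n \<and> ?d k dvd d}"
        using nd dvd_div_gcd_iff[OF n d, of "n div d * i"]
        by (auto, metis mult_less_cancel1)
    qed
    also have "\<dots> = of_bool (d = 1)"
    proof (cases "d = 1")
      case False
      have "?w ^ d = 1" using z d by (simp add: primitive_root_def flip: power_mult)
      moreover have "0 < n div d" "n div d < n" using False dvd_imp_le[OF d n] n dpos[OF d] by (auto simp: div_greater_zero_iff)
      then have "?w \<noteq> 1" using z unfolding primitive_root_def by blast
      ultimately show ?thesis using False by (simp add: geometric_sum)
    qed simp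
    finally show "(\<Sum>e | e dvd d. ?S e) = of_bool (d = 1)" .
  qed
  have "of_nat n * ell \<zeta> n = (\<Sum>k<n. Poly_Mapping.single (replicate_mset (gcd k n) (?d k)) (?z ^ k))"
    using n by (simp add: ell_eq_sum cycle_type_ncycle_funpow)
  also have "\<dots> = (\<Sum>d | d dvd n. \<Sum>k\<in>{k \<in> {..<n}. ?d k = d}. Poly_Mapping.single (replicate_mset (gcd k n) (?d k)) (?z ^ k))"
    by (rule sum.group[symmetric]) (use fin in \<open>auto simp: div_dvd_iff_mult\<close>)
  also have "\<dots> = (\<Sum>d | d dvd n. cst (moebius d) * pp d ^ (n div d))"
  proof (rule sum.cong[OF refl])
    fix d assume "d \<in> {d. d dvd n}"
    then have d: "d dvd n" by simp
    have "(\<Sum>k\<in>{k \<in> {..<n}. ?d k = d}. Poly_Mapping.single (replicate_mset (gcd k n) (?d k)) (?z ^ k))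
        = (\<Sum>k\<in>{k \<in> {..<n}. ?d k = d}. cst (?z ^ k) * pp d ^ (n div d))"
    proof (rule sum.cong[OF refl])
      fix k assume "k \<in> {k \<in> {..<n}. ?d k = d}"
      then have "?d k = d" by simp
      moreover have "gcd k n * (n div gcd k n) = n" by simp
      with \<open>?d k = d\<close> have "gcd k n * d = n" by (simp only:)
      then have "gcd k n = n div d" using dpos[OF d] by (metis nonzero_mult_div_cancel_right less_irrefl)
      ultimately show "Poly_Mapping.single (replicate_mset (gcd k n) (?d k)) (?z ^ k) = cst (?z ^ k) * pp d ^ (n div d)"
        by (simp add: pp_power mult_single)
    qed
    also have "\<dots> = cst (?S d) * pp d ^ (n div d)"
    proof -
      have "cst (sum f A) = (\<Sum>a\<in>A. cst (f a))" if "finite A" for f and A :: "nat set"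
        using that by (induction A) (auto simp: single_add)
      then show ?thesis by (simp add: sum_distrib_right)
    qed
    finally show "(\<Sum>k\<in>{k \<in> {..<n}. ?d k = d}. Poly_Mapping.single (replicate_mset (gcd k n) (?d k)) (?z ^ k))
        = cst (moebius d) * pp d ^ (n div d)" using S[OF d] by simp
  qed
  finally show ?thesis .
qed

section \<open>Generating functions\<close>

text \<open>\<open>logd F G\<close> says that \<open>G\<close> is the logarithmic derivative \<open>t F'/F\<close>; unlike \<open>log F\<close> it needs no
  division and makes sense over any commutative ring.\<close>
definition logd :: "'a::comm_ring_1 fps \<Rightarrow> 'a fps \<Rightarrow> bool" where
  "logd F G \<longleftrightarrow> fps_X * fps_deriv F = G * F"

lemma logd_iff: "logd F G \<longleftrightarrow> (\<forall>n. of_nat n * fps_nth F n = (\<Sum>i=0..n. fps_nth G i * fps_nth F (n - i)))"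
proof -
  have "fps_nth (fps_X * fps_deriv F) n = of_nat n * fps_nth F n" for n
    by (cases n) simp_all
  then show ?thesis by (simp add: logd_def fps_eq_iff fps_mult_nth)
qed

lemma logd_mult:
  assumes "logd F G" "logd F' G'"
  shows "logd (F * F') (G + G')"
proof -
  have "fps_X * fps_deriv (F * F') = F * (fps_X * fps_deriv F') + (fps_X * fps_deriv F) * F'"
    by (simp add: algebra_simps)
  also have "\<dots> = (G + G') * (F * F')"
    using assms by (simp add: logd_def algebra_simps)
  finally show ?thesis by (simp add: logd_def)
qed

lemma logd_prod:
  assumes "finite A" "\<And>j. j \<in> A \<Longrightarrow> logd (F j) (G j)"
  shows "logd (\<Prod>j\<in>A. F j) (\<Sum>j\<in>A. G j)"
  using assms
proof (induction A rule: finite_induct)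
  case empty
  show ?case by (simp add: logd_def)
qed (simp add: logd_mult)

text \<open>The constant term of G is 0, so the term containing F_n drops out of the right side of
  the recursion. The bound N allows a product truncated at parts up to N to be compared with a
  closed form.\<close>

lemma logd_unique:
  fixes F F' :: "symf fps"
  assumes "logd F G" "logd F' G'" "fps_nth F 0 = fps_nth F' 0"
    and "fps_nth G 0 = 0" "\<And>n. n \<le> N \<Longrightarrow> fps_nth G n = fps_nth G' n"
  shows "n \<le> N \<Longrightarrow> fps_nth F n = fps_nth F' n"
proof (induction n rule: less_induct)
  case (less n)
  show ?case
  proof (cases "n = 0")
    case False
    have "of_nat n * fps_nth F n = (\<Sum>i=0..n. fps_nth G i * fps_nth F (n - i))"
      using assms(1) by (simp add: logd_iff)
    also have "\<dots> = (\<Sum>i=0..n. fps_nth G' i * fps_nth F' (n - i))"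
    proof (rule sum.cong[OF refl])
      fix i assume i: "i \<in> {0..n}"
      have "fps_nth G' 0 = 0" using assms(4) assms(5)[of 0] by simp
      then show "fps_nth G i * fps_nth F (n - i) = fps_nth G' i * fps_nth F' (n - i)"
        using i less assms(4,5) by (cases "i = 0") auto
    qed
    also have "\<dots> = of_nat n * fps_nth F' n"
      using assms(2) by (simp add: logd_iff)
    finally show ?thesis by (rule of_nat_mult_cancel_symf) (use False in simp)
  qed (use assms(3) in simp)
qed

section \<open>Series in t^j and their logarithmic derivatives\<close>

definition dil :: "nat \<Rightarrow> (nat \<Rightarrow> 'a::zero) \<Rightarrow> 'a fps" where
  "dil j a = Abs_fps (\<lambda>n. if j dvd n then a (n div j) else 0)"

text \<open>If B = t A'/A, then A(t^j) has logarithmic derivative j B(t^j), with j from the chain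
  rule. Degree 0 is set to 0 because B has no constant term.\<close>

definition dillog :: "nat \<Rightarrow> (nat \<Rightarrow> 'a::comm_ring_1) \<Rightarrow> 'a fps" where
  "dillog j b = Abs_fps (\<lambda>n. if n > 0 \<and> j dvd n then of_nat j * b (n div j) else 0)"

lemma logd_dil:
  fixes a b :: "nat \<Rightarrow> 'a::comm_ring_1"
  assumes j: "j > 0" and newton: "\<And>m. of_nat m * a m = (\<Sum>k=1..m. b k * a (m - k))"
  shows "logd (dil j a) (dillog j b)"
  unfolding logd_iff
proof
  fix n
  let ?t = "\<lambda>i. fps_nth (dillog j b) i * fps_nth (dil j a) (n - i)"
  show "of_nat n * fps_nth (dil j a) n = (\<Sum>i=0..n. ?t i)"
  proof (cases "j dvd n")
    case False
    have "?t i = 0" if "i \<in> {0..n}" for i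
      using False that dvd_diffD[of j n i] by (auto simp: dil_def dillog_def)
    then show ?thesis using False by (simp add: dil_def)
  next
    case True
    then obtain m where m: "n = j * m" by auto
    have "(\<Sum>i=0..n. ?t i) = (\<Sum>i\<in>(*) j ` {1..m}. ?t i)"
    proof (rule sum.mono_neutral_right)
      show "\<forall>i\<in>{0..n} - (*) j ` {1..m}. ?t i = 0"
      proof
        fix i assume i: "i \<in> {0..n} - (*) j ` {1..m}"
        have "\<not> (i > 0 \<and> j dvd i)"
        proof
          assume "i > 0 \<and> j dvd i"
          then obtain k where k: "i = j * k" "i > 0" by auto
          then have "k \<in> {1..m}" using i m j by auto
          then show False using i k by auto
        qed
        then show "?t i = 0" by (auto simp: dillog_def)
      qed
    qed (use m j in auto)
    also have "\<dots> = (\<Sum>k=1..m. ?t (j * k))"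
      using j by (subst sum.reindex) (auto simp: inj_on_def)
    also have "\<dots> = (\<Sum>k=1..m. of_nat j * (b k * a (m - k)))"
    proof (rule sum.cong[OF refl])
      fix k assume k: "k \<in> {1..m}"
      have "n - j * k = j * (m - k)" using m by (simp add: diff_mult_distrib2)
      then show "?t (j * k) = of_nat j * (b k * a (m - k))"
        using k j by (simp add: dil_def dillog_def mult.assoc)
    qed
    also have "\<dots> = of_nat n * fps_nth (dil j a) n"
      using j m by (simp add: newton dil_def mult.assoc flip: sum_distrib_left)
    finally show ?thesis by simp
  qed
qed

text \<open>For fixed d the map from j to m = (n/j) d is an involution on the j with d | j | n. The
  new index m is that of the power sum p_(n/j)[p_d].\<close>

lemma sum_divisors_reindex:
  fixes F :: "nat \<Rightarrow> nat \<Rightarrow> 'a::comm_monoid_add"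
  assumes n: "n > 0"
  shows "(\<Sum>j | j dvd n. \<Sum>d | d dvd j. F j d) = (\<Sum>m | m dvd n. \<Sum>d | d dvd m. F (n div m * d) d)"
proof -
  have pos: "m > 0" if "m dvd n" for m using that n by (auto intro: gr0I)
  have fin: "finite {d. d dvd m}" if "m dvd n" for m using pos[OF that] by simp
  have inv: "d dvd n div j * d \<and> n div j * d dvd n \<and> n div (n div j * d) * d = j"
    if jd: "j dvd n" "d dvd j" for j d
  proof -
    obtain k where k: "n = j * k" using jd by auto
    obtain i where i: "j = d * i" using jd by auto
    have "d > 0" "i > 0" "k > 0" using n k i by auto
    then show ?thesis unfolding k i by simp
  qed
  have "(\<Sum>j | j dvd n. \<Sum>d | d dvd j. F j d) = (\<Sum>(j, d)\<in>(SIGMA j:{j. j dvd n}. {d. d dvd j}). F j d)"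
    using n fin by (intro sum.Sigma) auto
  also have "\<dots> = (\<Sum>(m, d)\<in>(SIGMA m:{m. m dvd n}. {d. d dvd m}). F (n div m * d) d)"
    by (rule sum.reindex_bij_witness[of _ "\<lambda>(m, d). (n div m * d, d)" "\<lambda>(j, d). (n div j * d, d)"])
      (use inv in auto)
  also have "\<dots> = (\<Sum>m | m dvd n. \<Sum>d | d dvd m. F (n div m * d) d)"
    using n fin by (intro sum.Sigma[symmetric]) auto
  finally show ?thesis .
qed

section \<open>Divisor sums produced by plethysm\<close>

lemma cst_mult: "cst (a * b) = cst a * cst b"
  by (simp add: mult_single)

lemma cst_sum: "cst (sum f A) = (\<Sum>a\<in>A. cst (f a))"
  by (induction A rule: infinite_finite_induct) (auto simp: single_add)

lemma pleth_p_cst_pp: "pleth_p k (cst c * pp d ^ i) = cst c * pp (k * d) ^ i"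
  by (simp add: pp_power mult_single pleth_p_single)

lemma omega_cst_pp: "d > 0 \<Longrightarrow> omega (cst c * pp d ^ i) = cst ((-1) ^ (d * i - i) * c) * pp d ^ i"
  by (simp add: pp_power mult_single omega_single mult.commute)

text \<open>Plethysm by p_(n/j) sends p_d^(j/d) to p_m^(j/d) with m = (n/j) d, and then j/d = n/m.
  Collecting by m puts j = (n/m) d and n/j = m/d into the weights.\<close>

lemma sum_pleth_p_divisors:
  assumes n: "n > 0"
    and g: "\<And>j. j > 0 \<Longrightarrow> of_nat j * g j = (\<Sum>d | d dvd j. cst (w j d) * pp d ^ (j div d))"
  shows "(\<Sum>j | j dvd n. of_nat j * (cst (\<epsilon> j (n div j)) * pleth_p (n div j) (g j))) =
    (\<Sum>m | m dvd n. cst (\<Sum>d | d dvd m. \<epsilon> (n div m * d) (m div d) * w (n div m * d) d) * pp m ^ (n div m))"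
proof -
  have "(\<Sum>j | j dvd n. of_nat j * (cst (\<epsilon> j (n div j)) * pleth_p (n div j) (g j)))
     = (\<Sum>j | j dvd n. \<Sum>d | d dvd j. cst (\<epsilon> j (n div j) * w j d) * pp (n div j * d) ^ (j div d))"
  proof (rule sum.cong[OF refl])
    fix j assume "j \<in> {j. j dvd n}"
    then have j: "j > 0" using n by (auto intro: gr0I)
    have "of_nat j * pleth_p (n div j) (g j) = pleth_p (n div j) (of_nat j * g j)"
      using additive_of_nat_mult[OF additive_pleth_p] by simp
    also have "\<dots> = (\<Sum>d | d dvd j. cst (w j d) * pp (n div j * d) ^ (j div d))"
      by (simp only: g[OF j] additive.sum[OF additive_pleth_p] pleth_p_cst_pp)
    finally have "of_nat j * (cst (\<epsilon> j (n div j)) * pleth_p (n div j) (g j))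
        = cst (\<epsilon> j (n div j)) * (\<Sum>d | d dvd j. cst (w j d) * pp (n div j * d) ^ (j div d))"
      by (simp only: mult.left_commute[of "of_nat j" "cst (\<epsilon> j (n div j))"])
    then show "of_nat j * (cst (\<epsilon> j (n div j)) * pleth_p (n div j) (g j))
        = (\<Sum>d | d dvd j. cst (\<epsilon> j (n div j) * w j d) * pp (n div j * d) ^ (j div d))"
      by (simp only: sum_distrib_left cst_mult mult.assoc)
  qed
  also have "\<dots> = (\<Sum>m | m dvd n. \<Sum>d | d dvd m. cst (\<epsilon> (n div m * d) (n div (n div m * d)) * w (n div m * d) d)
      * pp (n div (n div m * d) * d) ^ (n div m * d div d))"
    by (rule sum_divisors_reindex[OF n])
  also have "\<dots> = (\<Sum>m | m dvd n. \<Sum>d | d dvd m. cst (\<epsilon> (n div m * d) (m div d) * w (n div m * d) d) * pp m ^ (n div m))"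
  proof (intro sum.cong refl)
    fix m d assume "m \<in> {m. m dvd n}" "d \<in> {d. d dvd m}"
    then have "m dvd n" "d dvd m" by simp_all
    then obtain i k where ik: "n = m * i" "m = d * k" by (elim dvdE)
    have "d > 0" "i > 0" "k > 0" using n ik by auto
    then have "n div (n div m * d) = m div d" "m div d * d = m" "n div m * d div d = n div m"
      using ik by auto
    then show "cst (\<epsilon> (n div m * d) (n div (n div m * d)) * w (n div m * d) d)
        * pp (n div (n div m * d) * d) ^ (n div m * d div d)
      = cst (\<epsilon> (n div m * d) (m div d) * w (n div m * d) d) * pp m ^ (n div m)"
      by (simp only:)
  qed
  also have "\<dots> = (\<Sum>m | m dvd n. cst (\<Sum>d | d dvd m. \<epsilon> (n div m * d) (m div d) * w (n div m * d) d) * pp m ^ (n div m))"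
    by (simp only: cst_sum sum_distrib_right)
  finally show ?thesis .
qed

text \<open>The generating function of the modules \<open>Lie_\<lambda>\<close> or \<open>W_\<lambda>\<close> over partitions with parts in \<open>{2..N}\<close>.\<close>
definition hat_gf :: "(nat \<Rightarrow> nat \<Rightarrow> complex) \<Rightarrow> (nat \<Rightarrow> symf) \<Rightarrow> nat \<Rightarrow> symf fps" where
  "hat_gf \<epsilon> g N = (\<Prod>j=2..N. dil j (\<lambda>m. pleth (gsym (\<epsilon> j) m) (g j)))"

lemma dil_nth_0: "fps_nth (dil j a) 0 = a 0"
  by (simp add: dil_def)

lemma hat_gf_nth_0: "fps_nth (hat_gf \<epsilon> g N) 0 = 1"
proof -
  have "fps_nth (\<Prod>j\<in>A. F j) 0 = (\<Prod>j\<in>A. fps_nth (F j) 0)" for A :: "nat set" and F :: "nat \<Rightarrow> symf fps"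
    by (induction A rule: infinite_finite_induct) simp_all
  then show ?thesis by (simp add: hat_gf_def dil_nth_0 pleth_gsym_0)
qed

lemma hat_gf_logd:
  "logd (hat_gf \<epsilon> g N) (\<Sum>j=2..N. dillog j (\<lambda>k. cst (\<epsilon> j k) * pleth_p k (g j)))"
  unfolding hat_gf_def
  by (intro logd_prod logd_dil) (auto simp: pleth_gsym_newton)

text \<open>As n <= N, the range 2..N contains every divisor of n except j = 1. Since g 1 = p_1, the
  missing term is p_n[p_1] = p_n.\<close>

lemma hat_gf_logd_nth:
  assumes g: "\<And>j. j > 0 \<Longrightarrow> of_nat j * g j = (\<Sum>d | d dvd j. cst (w j d) * pp d ^ (j div d))"
    and g1: "g 1 = pp 1" and \<epsilon>1: "\<And>k. \<epsilon> 1 k = 1" and n: "n > 0" "n \<le> N"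
  shows "fps_nth (\<Sum>j=2..N. dillog j (\<lambda>k. cst (\<epsilon> j k) * pleth_p k (g j))) n =
    (\<Sum>m | m dvd n. cst (\<Sum>d | d dvd m. \<epsilon> (n div m * d) (m div d) * w (n div m * d) d) * pp m ^ (n div m)) - pp n"
proof -
  let ?t = "\<lambda>j. of_nat j * (cst (\<epsilon> j (n div j)) * pleth_p (n div j) (g j))"
  have fin: "finite {j. j dvd n}" using n by simp
  have "fps_nth (\<Sum>j=2..N. dillog j (\<lambda>k. cst (\<epsilon> j k) * pleth_p k (g j))) n
      = (\<Sum>j=2..N. if j dvd n then ?t j else 0)"
    using n by (simp add: fps_sum_nth dillog_def cong: if_cong)
  also have "\<dots> = sum ?t ({j. j dvd n} - {1})"
  proof (rule sum.mono_neutral_cong_right)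
    show "{j. j dvd n} - {1} \<subseteq> {2..N}"
    proof
      fix j assume "j \<in> {j. j dvd n} - {1}"
      then have "j dvd n" "j \<noteq> 1" by auto
      moreover from this have "j > 0" "j \<le> n" using n by (auto intro: gr0I dvd_imp_le)
      ultimately show "j \<in> {2..N}" using n by auto
    qed
  qed auto
  also have "\<dots> = sum ?t {j. j dvd n} - ?t 1"
    using fin by (simp add: sum_diff1)
  also have "?t 1 = pp n"
    using pleth_p_cst_pp[of n 1 1 1] by (simp add: \<epsilon>1[simplified] g1[simplified])
  finally show ?thesis using sum_pleth_p_divisors[OF n(1) g] by simp
qed

section \<open>Closed forms of the two generating functions\<close>

lemma newton_power: "of_nat m * p ^ m = (\<Sum>k=1..m. p ^ k * p ^ (m - k))" for p :: "'a::comm_ring_1"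
proof -
  have "(\<Sum>k=1..m. p ^ k * p ^ (m - k)) = (\<Sum>k=1..m. p ^ m)"
    by (rule sum.cong) (simp_all flip: power_add)
  then show ?thesis by simp
qed

text \<open>The weight -1 negates the exponent in H(t) = exp(sum of p_k t^k / k), so the first
  factor is 1 / H(t) = E(-t); the second is 1 / (1 - p_1 t).\<close>

definition lie_gf :: "symf fps" where
  "lie_gf = dil 1 (gsym (\<lambda>_. -1)) * dil 1 (\<lambda>n. pp 1 ^ n)"

lemma lie_gf_logd: "logd lie_gf (dillog 1 (\<lambda>k. - pp k) + dillog 1 (\<lambda>k. pp 1 ^ k))"
  unfolding lie_gf_def
  by (intro logd_mult logd_dil) (simp_all add: gsym_newton newton_power single_uminus)

lemma lie_gf_nth_0: "fps_nth lie_gf 0 = 1"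
  by (simp add: lie_gf_def dil_nth_0 gsym_0)

lemma hat_gf_lie:
  assumes z: "\<forall>n\<ge>1. primitive_root (\<zeta> n) n" and "n \<le> N"
  shows "fps_nth (hat_gf (\<lambda>_ _. 1) (ell \<zeta>) N) n = fps_nth lie_gf n"
proof (rule logd_unique[OF hat_gf_logd lie_gf_logd _ _ _ \<open>n \<le> N\<close>])
  have ell: "of_nat j * ell \<zeta> j = (\<Sum>d | d dvd j. cst (moebius d) * pp d ^ (j div d))" if "j > 0" for j
    using ell_formula that z by simp
  have moebius1: "moebius 1 = 1" by (simp add: moebius.simps)
  have ell1: "ell \<zeta> 1 = pp 1" using ell[of 1] moebius1 by simp
  show "fps_nth (\<Sum>j=2..N. dillog j (\<lambda>k. cst 1 * pleth_p k (ell \<zeta> j))) n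
      = fps_nth (dillog 1 (\<lambda>k. - pp k) + dillog 1 (\<lambda>k. pp 1 ^ k)) n" if "n \<le> N" for n
  proof (cases "n = 0")
    case False
    then have n: "n > 0" by simp
    have "(\<Sum>m | m dvd n. cst (\<Sum>d | d dvd m. 1 * moebius d) * pp m ^ (n div m))
        = (\<Sum>m | m dvd n. if m = 1 then pp 1 ^ n else 0)"
    proof (rule sum.cong[OF refl])
      fix m assume "m \<in> {m. m dvd n}"
      then have "m > 0" using n by (auto intro: gr0I)
      then show "cst (\<Sum>d | d dvd m. 1 * moebius d) * pp m ^ (n div m) = (if m = 1 then pp 1 ^ n else 0)"
        by (simp add: sum_moebius)
    qed
    then show ?thesis
      using hat_gf_logd_nth[of "ell \<zeta>" "\<lambda>j d. moebius d" "\<lambda>_ _. 1", OF ell ell1 refl n that] n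
      by (simp add: dillog_def)
  qed (simp add: fps_sum_nth dillog_def)
qed (simp_all add: hat_gf_nth_0 lie_gf_nth_0 fps_sum_nth dillog_def)

text \<open>The second factor is 1 + p_2 u at u = t^2, written as a dilation so that
  \<open>logd_dil\<close> supplies its logarithmic derivative.\<close>

definition w_gf :: "symf fps" where
  "w_gf = lie_gf * dil 2 (\<lambda>k. if k = 0 then 1 else if k = 1 then pp 2 else 0)"

lemma w_gf_nth_0: "fps_nth w_gf 0 = 1"
  by (simp add: w_gf_def dil_nth_0 lie_gf_nth_0)

lemma w_gf_logd:
  "logd w_gf (dillog 1 (\<lambda>k. - pp k) + dillog 1 (\<lambda>k. pp 1 ^ k) + dillog 2 (\<lambda>k. - ((- pp 2) ^ k)))"
  unfolding w_gf_def
proof (intro logd_mult lie_gf_logd logd_dil)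
  let ?a = "\<lambda>k. if k = 0 then 1 else if k = 1 then pp 2 else 0"
  fix m
  \<comment> \<open>This expands p_2 u / (1 + p_2 u). In degree m >= 2 only k = m and k = m - 1 meet
    a nonzero coefficient, and they cancel.\<close>
  show "of_nat m * ?a m = (\<Sum>k=1..m. - ((- pp 2) ^ k) * ?a (m - k))"
  proof (cases m)
    case (Suc l)
    have "(\<Sum>k=1..m. - ((- pp 2) ^ k) * ?a (m - k))
        = - ((- pp 2) ^ Suc l) + (\<Sum>k=1..l. - ((- pp 2) ^ k) * ?a (Suc l - k))"
      unfolding Suc by (simp add: sum.cl_ivl_Suc)
    also have "(\<Sum>k=1..l. - ((- pp 2) ^ k) * ?a (Suc l - k)) = (\<Sum>k=1..l. if k = l then - ((- pp 2) ^ l) * pp 2 else 0)"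
      by (rule sum.cong) auto
    also have "\<dots> = (if l = 0 then 0 else - ((- pp 2) ^ l) * pp 2)"
      by (simp add: sum.delta)
    finally show ?thesis using Suc by (cases "l = 0") (auto simp: mult.commute)
  qed simp
qed simp

text \<open>For k = m/d write (-1)^(k-1) as 1 - 2 [k even]. The d with m/d even are the divisors of
  m/2, whose Moebius sum is nonzero only for m = 2.\<close>

lemma sum_moebius_alternating:
  assumes m: "m > 0"
  shows "(\<Sum>d | d dvd m. (-1) ^ (m div d - 1) * moebius d) = of_bool (m = 1) - 2 * of_bool (m = 2)"
proof -
  have fin: "finite {d. d dvd m}" using m by simp
  have "(\<Sum>d | d dvd m. (-1) ^ (m div d - 1) * moebius d)
      = (\<Sum>d | d dvd m. moebius d - 2 * (if even (m div d) then moebius d else 0))"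
  proof (rule sum.cong[OF refl])
    fix d assume "d \<in> {d. d dvd m}"
    then have "m div d > 0" using m by (auto elim!: dvdE)
    then show "(-1) ^ (m div d - 1) * moebius d = moebius d - 2 * (if even (m div d) then moebius d else 0)"
      by (simp add: minus_one_power_iff)
  qed
  also have "\<dots> = of_bool (m = 1) - 2 * (\<Sum>d | d dvd m \<and> even (m div d). moebius d)"
    using fin m by (simp add: sum_subtractf sum_moebius sum.If_cases Int_def flip: sum_distrib_left)
  also have "(\<Sum>d | d dvd m \<and> even (m div d). moebius d) = of_bool (m = 2)"
  proof (cases "even m")
    case True
    then obtain h where h: "m = 2 * h" by auto
    then have hp: "h > 0" using m by simp
    have "d dvd m \<and> even (m div d) \<longleftrightarrow> d dvd h" for d
    proof
      assume "d dvd m \<and> even (m div d)"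
      then obtain a where "m = d * (2 * a)" using m by (metis dvd_mult_div_cancel evenE)
      then have "h = d * a" using h by simp
      then show "d dvd h" by simp
    next
      assume "d dvd h"
      then obtain a where "h = d * a" by auto
      then show "d dvd m \<and> even (m div d)" using h hp by (auto simp: div_mult_self1_is_m)
    qed
    then show ?thesis using sum_moebius[OF hp] h by auto
  next
    case False
    then have "{d. d dvd m \<and> even (m div d)} = {}" 
      by (metis (no_types, lifting) Collect_empty_eq dvd_mult dvd_mult_div_cancel)
    moreover have "m \<noteq> 2" using False by auto
    ultimately show ?thesis by (simp only: sum.empty) simp
  qed
  finally show ?thesis .
qed

text \<open>With j = i d and m = d k, the left side is the sign from the choice between h and e
  times the sign from omega. The right side isolates a factor depending only on i and m, which
  leaves the divisor sum.\<close>

lemma w_sign: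
  assumes "i > 0" "d > 0" "k > 0"
  shows "(-1) ^ ((k - 1) * (i * d - 1)) * (-1) ^ (i * d - i) = ((-1) ^ (i * (d * k - 1)) * (-1) ^ (k - 1) :: complex)"
proof -
  \<comment> \<open>Successors turn the truncated subtractions into polynomials; the two exponents
    then differ by the even number 2 (k - 1).\<close>
  obtain a b c where "i = Suc a" "d = Suc b" "k = Suc c"
    using assms by (metis not0_implies_Suc less_irrefl)
  then have e: "i * (d * k - 1) + (k - 1) = (k - 1) * (i * d - 1) + (i * d - i) + 2 * (k - 1)"
    by (simp add: algebra_simps)
  have "(-1) ^ (i * (d * k - 1)) * (-1) ^ (k - 1) = ((-1) ^ (i * (d * k - 1) + (k - 1)) :: complex)"
    by (simp only: power_add)
  also have "\<dots> = (-1) ^ ((k - 1) * (i * d - 1)) * (-1) ^ (i * d - i)"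
    unfolding e by (simp only: power_add power_mult) simp
  finally show ?thesis by (rule sym)
qed

text \<open>For odd j this is the weight 1 of h, for even j the weight (-1)^(k-1) of e; a single
  formula lets both enter one divisor sum.\<close>

definition w_eps :: "nat \<Rightarrow> nat \<Rightarrow> complex" where
  "w_eps j k = (-1) ^ ((k - 1) * (j - 1))"

lemma hat_gf_w:
  assumes z: "\<forall>n\<ge>1. primitive_root (\<zeta> n) n" and "n \<le> N"
  shows "fps_nth (hat_gf w_eps (piS \<zeta>) N) n = fps_nth w_gf n"
proof (rule logd_unique[OF hat_gf_logd w_gf_logd _ _ _ \<open>n \<le> N\<close>])
  define w where "w j d = (-1) ^ (j - j div d) * moebius d" for j d
  have piS: "of_nat j * piS \<zeta> j = (\<Sum>d | d dvd j. cst (w j d) * pp d ^ (j div d))" if j: "j > 0" for j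
  proof -
    have "of_nat j * piS \<zeta> j = omega (of_nat j * ell \<zeta> j)"
      using additive_of_nat_mult[OF additive_omega] by (simp add: piS_def)
    also have "\<dots> = (\<Sum>d | d dvd j. omega (cst (moebius d) * pp d ^ (j div d)))"
      using ell_formula[OF j] z j by (simp add: additive.sum[OF additive_omega])
    also have "\<dots> = (\<Sum>d | d dvd j. cst (w j d) * pp d ^ (j div d))"
    proof (rule sum.cong[OF refl])
      fix d assume "d \<in> {d. d dvd j}"
      then have "d > 0" "d * (j div d) = j" using j by (auto intro: gr0I)
      then show "omega (cst (moebius d) * pp d ^ (j div d)) = cst (w j d) * pp d ^ (j div d)"
        by (simp add: omega_cst_pp w_def)
    qed
    finally show ?thesis .
  qed
  have moebius1: "moebius 1 = 1" by (simp add: moebius.simps)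
  have piS1: "piS \<zeta> 1 = pp 1" using piS[of 1] moebius1 by (simp add: w_def)
  show "fps_nth (\<Sum>j=2..N. dillog j (\<lambda>k. cst (w_eps j k) * pleth_p k (piS \<zeta> j))) n
      = fps_nth (dillog 1 (\<lambda>k. - pp k) + dillog 1 (\<lambda>k. pp 1 ^ k) + dillog 2 (\<lambda>k. - ((- pp 2) ^ k))) n"
    if "n \<le> N" for n
  proof (cases "n = 0")
    case False
    then have n: "n > 0" by simp
    have fin: "finite {m. m dvd n}" using n by simp
    \<comment> \<open>The contribution of m = 2: there i (m - 1) = n/2, and the alternating divisor
      sum is -2.\<close>
    let ?q = "cst ((-1) ^ (n div 2) * (-2)) * pp 2 ^ (n div 2)"
    have "(\<Sum>m | m dvd n. cst (\<Sum>d | d dvd m. w_eps (n div m * d) (m div d) * w (n div m * d) d) * pp m ^ (n div m))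
        = (\<Sum>m | m dvd n. (if m = 1 then pp 1 ^ n else 0) + (if m = 2 then ?q else 0))"
    proof (rule sum.cong[OF refl])
      fix m assume "m \<in> {m. m dvd n}"
      then obtain i where i: "n = m * i" by auto
      then have mi: "m > 0" "i > 0" "n div m = i" using n by auto
      have "(\<Sum>d | d dvd m. w_eps (n div m * d) (m div d) * w (n div m * d) d)
          = (\<Sum>d | d dvd m. (-1) ^ (i * (m - 1)) * ((-1) ^ (m div d - 1) * moebius d))"
      proof (rule sum.cong[OF refl])
        fix d assume "d \<in> {d. d dvd m}"
        then obtain k where k: "m = d * k" by auto
        then have dk: "d > 0" "k > 0" "m div d = k" using mi by auto
        show "w_eps (n div m * d) (m div d) * w (n div m * d) d
            = (-1) ^ (i * (m - 1)) * ((-1) ^ (m div d - 1) * moebius d)"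
          using w_sign[OF mi(2) dk(1,2)] dk mi k by (simp add: w_eps_def w_def)
      qed
      also have "\<dots> = (-1) ^ (i * (m - 1)) * (of_bool (m = 1) - 2 * of_bool (m = 2))"
        by (simp only: sum_moebius_alternating[OF mi(1)] flip: sum_distrib_left)
      finally show "cst (\<Sum>d | d dvd m. w_eps (n div m * d) (m div d) * w (n div m * d) d) * pp m ^ (n div m)
          = (if m = 1 then pp 1 ^ n else 0) + (if m = 2 then ?q else 0)"
        using mi i by auto
    qed
    also have "\<dots> = pp 1 ^ n + (if even n then ?q else 0)"
      using fin n by (simp add: sum.distrib sum.delta)
    also have "?q = 2 * (- ((- pp 2) ^ (n div 2)))"
    proof -
      have "cst ((-1) ^ (n div 2) * (-2)) = (-1) ^ (n div 2) * (- 2)"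
        by (auto simp: minus_one_power_iff single_uminus)
      then show ?thesis by (simp add: power_minus[of "pp 2"])
    qed
    finally show ?thesis
      using hat_gf_logd_nth[of "piS \<zeta>" w w_eps, OF piS piS1 _ n that] n
      by (simp add: dillog_def w_eps_def)
  qed (simp add: fps_sum_nth dillog_def)
qed (simp_all add: hat_gf_nth_0 w_gf_nth_0 fps_sum_nth dillog_def)

section \<open>Partitions without parts equal to 1, and induction\<close>

definition mparts :: "nat set \<Rightarrow> nat \<Rightarrow> nat multiset set" where
  "mparts A n = {lam. set_mset lam \<subseteq> A \<and> sum_mset lam = n}"

lemma sum_mset_filter_neq: "sum_mset lam = a * count lam a + sum_mset (filter_mset (\<lambda>x. x \<noteq> a) lam)"
  for lam :: "nat multiset"
  by (induction lam) auto

lemma filter_neq_replicate: "filter_mset (\<lambda>x. x \<noteq> a) lam + replicate_mset (count lam a) a = lam"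
  by (rule multiset_eqI) auto

text \<open>A degree i from the factor of a new part a stands for i / a copies of a. Finiteness is
  proved in the same induction because splitting the sum requires it: in HOL sums over infinite sets
  are 0.\<close>

lemma prod_dil_nth:
  fixes f :: "nat \<Rightarrow> nat \<Rightarrow> 'a::comm_ring_1"
  assumes "finite A" "0 \<notin> A" "\<And>j. f j 0 = 1"
  shows "finite (mparts A n) \<and>
    fps_nth (\<Prod>j\<in>A. dil j (f j)) n = (\<Sum>lam\<in>mparts A n. \<Prod>j\<in>A. f j (count lam j))"
  using assms
proof (induction A arbitrary: n rule: finite_induct)
  case empty
  have "mparts {} n = (if n = 0 then {{#}} else {})" by (auto simp: mparts_def)
  then show ?case by simp
next
  case (insert a A)
  then have a: "a > 0" "a \<notin> A" and A0: "0 \<notin> A" by auto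
  have IH: "finite (mparts A n)"
      "fps_nth (\<Prod>j\<in>A. dil j (f j)) n = (\<Sum>lam\<in>mparts A n. \<Prod>j\<in>A. f j (count lam j))" for n
    using insert by auto
  define I where "I = {i \<in> {0..n}. a dvd i}"
  define T where "T = (SIGMA i:I. mparts A (n - i))"
  let ?to = "\<lambda>(i, lam). lam + replicate_mset (i div a) a"
  let ?from = "\<lambda>lam. (a * count lam a, filter_mset (\<lambda>x. x \<noteq> a) lam)"
  have finI: "finite I" by (simp add: I_def)
  have from_T: "?from lam \<in> T" "?to (?from lam) = lam" if "lam \<in> mparts (insert a A) n" for lam
    using that a sum_mset_filter_neq[of lam a] filter_neq_replicate[of a lam]
    by (auto simp: T_def I_def mparts_def)
  have to_T: "?to x \<in> mparts (insert a A) n" "?from (?to x) = x" if x: "x \<in> T" for x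
  proof -
    obtain i lam where il: "x = (i, lam)" by (cases x)
    then have i: "i \<le> n" "a dvd i" and lam: "set_mset lam \<subseteq> A" "sum_mset lam = n - i"
      using x by (auto simp: T_def I_def mparts_def)
    have "a \<notin># lam" using lam a by auto
    then have c0: "count lam a = 0" by (simp add: count_eq_zero_iff)
    moreover have "filter_mset (\<lambda>x. x \<noteq> a) lam = lam"
      by (rule multiset_eqI) (use c0 in auto)
    ultimately have "count lam a = 0" "filter_mset (\<lambda>x. x \<noteq> a) lam = lam" by blast+
    then show "?to x \<in> mparts (insert a A) n" "?from (?to x) = x"
      using i lam a by (auto simp: il mparts_def)
  qed
  have "mparts (insert a A) n \<subseteq> ?to ` T"
    using from_T by (metis (no_types, lifting) image_eqI subsetI)
  then have fin: "finite (mparts (insert a A) n)"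
    by (rule finite_subset) (use finI IH(1) in \<open>auto simp: T_def\<close>)
  have "fps_nth (\<Prod>j\<in>insert a A. dil j (f j)) n
      = (\<Sum>i=0..n. fps_nth (dil a (f a)) i * fps_nth (\<Prod>j\<in>A. dil j (f j)) (n - i))"
    using insert.hyps by (simp add: fps_mult_nth)
  also have "\<dots> = (\<Sum>i\<in>I. f a (i div a) * (\<Sum>lam\<in>mparts A (n - i). \<Prod>j\<in>A. f j (count lam j)))"
    by (rule sum.mono_neutral_cong_right) (auto simp: I_def IH(2), auto simp: dil_def split: if_splits)
  also have "\<dots> = (\<Sum>(i, lam)\<in>T. f a (i div a) * (\<Prod>j\<in>A. f j (count lam j)))"
    unfolding sum_distrib_left T_def using finI IH(1) by (intro sum.Sigma) auto
  also have "\<dots> = (\<Sum>lam\<in>mparts (insert a A) n. \<Prod>j\<in>insert a A. f j (count lam j))"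
  proof (rule sum.reindex_bij_witness[of _ ?from ?to])
    fix x assume "x \<in> T"
    then show "?from (?to x) = x" "?to x \<in> mparts (insert a A) n" using to_T by auto
  next
    fix lam assume "lam \<in> mparts (insert a A) n"
    then show "?to (?from lam) = lam" "?from lam \<in> T" using from_T by blast+
  next
    fix x assume x: "x \<in> T"
    obtain i lam where il: "x = (i, lam)" by (cases x)
    then have lam: "set_mset lam \<subseteq> A" using x by (auto simp: T_def mparts_def)
    then have "count lam a = 0" using a by (auto simp: not_in_iff[symmetric])
    moreover have "(\<Prod>j\<in>A. f j (count (lam + replicate_mset (i div a) a) j)) = (\<Prod>j\<in>A. f j (count lam j))"
      using a by (intro prod.cong) auto
    ultimately show "(\<Prod>j\<in>insert a A. f j (count (?to x) j))
        = (case x of (i, lam) \<Rightarrow> f a (i div a) * (\<Prod>j\<in>A. f j (count lam j)))"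
      using insert.hyps by (simp add: il)
  qed
  finally show ?case using fin by simp
qed

text \<open>Ranks are at most n, so summing over them only undoes a grouping; the parts are bounded
  by their sum n.\<close>

lemma sum_hat_parts:
  fixes F :: "nat multiset \<Rightarrow> 'a::comm_monoid_add"
  shows "(\<Sum>i\<le>n. \<Sum>lam\<in>hat_parts n i. F lam) = (\<Sum>lam\<in>mparts {2..n} n. F lam)"
proof -
  have fin: "finite (mparts {2..n} n)"
    using prod_dil_nth[of "{2..n}" "\<lambda>_ _. 1 :: int" n] by simp
  have le: "j \<le> sum_mset lam" if "j \<in># lam" for j and lam :: "nat multiset"
    using sum_mset.remove[OF that] by simp
  have "hat_parts n i = {lam \<in> mparts {2..n} n. rank_part lam = i}" for i
    using le by (auto simp: hat_parts_def mparts_def)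
  then have "(\<Sum>i\<le>n. \<Sum>lam\<in>hat_parts n i. F lam)
      = (\<Sum>i\<le>n. \<Sum>lam\<in>{lam \<in> mparts {2..n} n. rank_part lam = i}. F lam)"
    by (simp only:)
  also have "\<dots> = (\<Sum>lam\<in>mparts {2..n} n. F lam)"
    by (rule sum.group[OF fin]) (auto simp: rank_part_def mparts_def)
  finally show ?thesis .
qed

section \<open>Passing back to characters\<close>

lemma chinv_sum: "chinv n (sum f A) \<sigma> = (\<Sum>a\<in>A. chinv n (f a) \<sigma>)"
  by (simp add: chinv_def lookup_sum sum_distrib_left)

lemma chinv_add: "chinv n (f + g) \<sigma> = chinv n f \<sigma> + chinv n g \<sigma>"
  by (simp add: chinv_def lookup_add distrib_left)

lemma chinv_diff: "chinv n (f - g) \<sigma> = chinv n f \<sigma> - chinv n g \<sigma>"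
  by (simp add: chinv_def lookup_minus right_diff_distrib)

lemma chinv_cst_mult: "chinv n (cst c * f) \<sigma> = c * chinv n f \<sigma>"
  by (simp add: chinv_def)

lemma sum_hat_parts_chinv:
  assumes "\<And>lam j. j \<in># lam \<Longrightarrow> j > 0 \<Longrightarrow> F lam j = pleth (gsym (\<epsilon> j) (count lam j)) (g j)"
  shows "(\<Sum>i\<le>n. \<Sum>lam\<in>hat_parts n i. chinv (sum_mset lam) (\<Prod>j\<in>set_mset lam. F lam j) \<sigma>)
    = chinv n (fps_nth (hat_gf \<epsilon> g n) n) \<sigma>"
proof -
  let ?f = "\<lambda>j m. pleth (gsym (\<epsilon> j) m) (g j)"
  have "(\<Sum>i\<le>n. \<Sum>lam\<in>hat_parts n i. chinv (sum_mset lam) (\<Prod>j\<in>set_mset lam. F lam j) \<sigma>)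
      = (\<Sum>lam\<in>mparts {2..n} n. chinv n (\<Prod>j=2..n. ?f j (count lam j)) \<sigma>)"
    unfolding sum_hat_parts
  proof (rule sum.cong[OF refl])
    fix lam assume lam: "lam \<in> mparts {2..n} n"
    have "(\<Prod>j\<in>set_mset lam. F lam j) = (\<Prod>j=2..n. ?f j (count lam j))"
      using lam by (intro prod.mono_neutral_cong_left)
        (auto simp: mparts_def assms pleth_gsym_0 not_in_iff)
    then show "chinv (sum_mset lam) (\<Prod>j\<in>set_mset lam. F lam j) \<sigma> = chinv n (\<Prod>j=2..n. ?f j (count lam j)) \<sigma>"
      using lam by (simp add: mparts_def)
  qed
  also have "\<dots> = chinv n (fps_nth (hat_gf \<epsilon> g n) n) \<sigma>"
    using prod_dil_nth[of "{2..n}" ?f n] by (simp add: chinv_sum hat_gf_def pleth_gsym_0)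
  finally show ?thesis .
qed

lemma LieHat_chinv:
  assumes "\<forall>n\<ge>1. primitive_root (\<zeta> n) n"
  shows "LieHat \<zeta> n \<sigma> = chinv n (fps_nth lie_gf n) \<sigma>"
  unfolding LieHat_def LieHat_i_def Lie_part_def
  by (subst sum_hat_parts_chinv[where \<epsilon> = "\<lambda>_ _. 1" and g = "ell \<zeta>"])
    (simp_all add: hsym_gsym hat_gf_lie[OF assms])

lemma w_eps_gsym:
  assumes "j > 0"
  shows "gsym (w_eps j) m = (if odd j then hsym m else esym m)"
proof -
  have "w_eps j = (if odd j then (\<lambda>_. 1) else (\<lambda>k. (-1) ^ (k - 1)))"
    using assms by (auto simp: w_eps_def fun_eq_iff minus_one_power_iff)
  then show ?thesis by (simp add: hsym_gsym esym_gsym)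
qed

lemma WHat_chinv:
  assumes "\<forall>n\<ge>1. primitive_root (\<zeta> n) n"
  shows "WHat \<zeta> n \<sigma> = chinv n (fps_nth w_gf n) \<sigma>"
  unfolding WHat_def WHat_i_def W_part_def
  by (subst sum_hat_parts_chinv[where \<epsilon> = w_eps and g = "piS \<zeta>"])
    (simp_all add: w_eps_gsym hat_gf_w[OF assms])

section \<open>Induction as multiplication by p_1\<close>

lemma sum_Sym_indicator:
  assumes "F \<subseteq> {..<Suc m}"
  shows "(\<Sum>g\<in>Sym (Suc m). if g m \<in> F then 1 else 0) = (of_nat (fact m * card F) :: 'a::comm_semiring_1)"
proof -
  have "(\<Sum>g\<in>Sym (Suc m). if g m \<in> F then 1 else 0 :: 'a)
      = (\<Sum>q\<in>Sym m. (if m \<in> F then 1 else 0) + (\<Sum>b<m. if b \<in> F then 1 else 0))"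
    unfolding sum_Sym_Suc
  proof (rule sum.cong[OF refl])
    fix q assume "q \<in> Sym m"
    then have "q m = m" by (auto simp: Sym_def dest: permutes_not_in)
    then show "(if q m \<in> F then 1 else 0 :: 'a) + (\<Sum>b<m. if (Transposition.transpose m b \<circ> q) m \<in> F then 1 else 0)
        = (if m \<in> F then 1 else 0) + (\<Sum>b<m. if b \<in> F then 1 else 0)"
      by simp
  qed
  also have "(if m \<in> F then 1 else 0) + (\<Sum>b<m. if b \<in> F then 1 else 0) = (\<Sum>b\<in>{..<Suc m}. if b \<in> F then 1 else 0 :: 'a)"
    by (simp add: add.commute)
  also have "\<dots> = of_nat (card F)"
    using assms by (simp add: sum.If_cases Int_absorb1 del: sum.lessThan_Suc)
  finally show ?thesis by (simp add: card_Sym)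
qed

text \<open>The conjugate of sigma by g lies in S_m exactly when \<open>inv g m\<close> is a fixed
  point of sigma, and its type is then mu without one 1. Each fixed point comes from m! elements g,
  so count mu 1 appears, the same factor by which z_mu exceeds z of the smaller type.\<close>

lemma indS_chinv:
  assumes s: "\<sigma> \<in> Sym (Suc m)"
  shows "indS (Suc m) (chinv m f) \<sigma> = chinv (Suc m) (pp 1 * f) \<sigma>"
proof -
  have sp: "\<sigma> permutes {..<Suc m}" using s by (simp add: Sym_def)
  let ?mu = "cycle_type (Suc m) \<sigma>"
  define F where "F = {b. b < Suc m \<and> \<sigma> b = b}"
  define c :: complex where "c = of_nat (zee (?mu - {#1#})) * Poly_Mapping.lookup f (?mu - {#1#})"
  have summand: "(if (g \<circ> \<sigma> \<circ> inv g) permutes {..<m} then chinv m f (g \<circ> \<sigma> \<circ> inv g) else 0)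
      = (if inv g m \<in> F then 1 else 0) * c" if g: "g \<in> Sym (Suc m)" for g
  proof -
    let ?t = "g \<circ> \<sigma> \<circ> inv g"
    have gp: "g permutes {..<Suc m}" using g by (simp add: Sym_def)
    have tp: "?t permutes {..<Suc m}"
      using gp sp permutes_inv[OF gp] by (intro permutes_compose)
    have "?t m = m \<longleftrightarrow> \<sigma> (inv g m) = inv g m"
      using permutes_inverses[OF gp] permutes_inv_eq[OF gp] by (metis comp_apply)
    moreover have "inv g m < Suc m"
      using permutes_in_image[OF permutes_inv[OF gp], of m] by simp
    ultimately have "?t m = m \<longleftrightarrow> inv g m \<in> F" by (simp add: F_def)
    moreover have "?t permutes {..<m} \<longleftrightarrow> ?t m = m"
    proof
      assume "?t permutes {..<m}"
      then show "?t m = m" by (rule permutes_not_in) simp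
    next
      assume "?t m = m"
      then show "?t permutes {..<m}"
        by (intro permutes_superset[OF tp]) (auto simp: less_Suc_eq)
    qed
    moreover have "chinv m f ?t = c" if "?t permutes {..<m}"
    proof -
      have "?t \<in> Sym m" using that by (simp add: Sym_def)
      then have "cycle_type (Suc m) ?t = add_mset 1 (cycle_type m ?t)" by (rule cycle_type_fix)
      moreover have "cycle_type (Suc m) ?t = ?mu" using s g by (rule cycle_type_conj)
      ultimately have "cycle_type m ?t = ?mu - {#1#}" by simp
      then show ?thesis by (simp only: chinv_def c_def)
    qed
    ultimately show ?thesis by simp
  qed
  have "indS (Suc m) (chinv m f) \<sigma> = 1 / fact m * (\<Sum>g\<in>Sym (Suc m). (if inv g m \<in> F then 1 else 0) * c)"
    unfolding indS_def using summand by (simp cong: sum.cong)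
  also have "\<dots> = 1 / fact m * (\<Sum>g\<in>Sym (Suc m). (if g m \<in> F then 1 else 0)) * c"
    unfolding Sym_def by (subst (2) sum_permutations_inverse) (simp add: sum_distrib_right)
  also have "\<dots> = of_nat (card F) * c"
    by (subst sum_Sym_indicator) (auto simp: F_def)
  also have "card F = count ?mu 1"
    unfolding F_def by (rule card_fixpoints[OF s])
  also have "of_nat (count ?mu 1) * c = chinv (Suc m) (pp 1 * f) \<sigma>"
  proof (cases "1 \<in># ?mu")
    case True
    then show ?thesis
      using zee_remove[OF True] by (simp add: c_def chinv_def lookup_pp_mult)
  next
    case False
    then show ?thesis by (simp add: chinv_def lookup_pp_mult count_eq_zero_iff)
  qed
  finally show ?thesis .
qed

section \<open>Recursions for the coefficients of the two series\<close>

lemma chinv_gsym: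
  assumes s: "\<sigma> \<in> Sym n"
  shows "chinv n (gsym \<epsilon> n) \<sigma> = (\<Prod>k\<in>#cycle_type n \<sigma>. \<epsilon> k)"
  using sum_cycle_type[OF s] cycle_type_not_zero[OF s] zee_pos[OF cycle_type_not_zero[OF s]]
  by (simp add: chinv_def lookup_gsym)

lemma chinv_esym:
  assumes s: "\<sigma> \<in> Sym n"
  shows "chinv n (esym n) \<sigma> = of_int (sign \<sigma>)"
  using chinv_gsym[OF s] prod_mset_sign[OF cycle_type_not_zero[OF s]] sum_cycle_type[OF s]
  by (simp add: esym_gsym sign_cycle_type[OF s])

lemma chinv_hsym: "\<sigma> \<in> Sym n \<Longrightarrow> chinv n (hsym n) \<sigma> = 1"
  by (simp add: chinv_gsym hsym_gsym)

lemma gsym_minus_one: "gsym (\<lambda>_. -1) n = cst ((-1) ^ n) * esym n"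
proof (rule poly_mapping_eqI)
  fix \<mu> :: "nat multiset"
  have "(\<Prod>k\<in>#\<mu>. -1 :: complex) = (-1) ^ sum_mset \<mu> * (\<Prod>k\<in>#\<mu>. (-1) ^ (k - 1))" if "0 \<notin># \<mu>"
    using prod_mset_sign[OF that] by (simp add: minus_one_power_iff)
  then show "Poly_Mapping.lookup (gsym (\<lambda>_. -1) n) \<mu> = Poly_Mapping.lookup (cst ((-1) ^ n) * esym n) \<mu>"
    by (auto simp: lookup_gsym esym_gsym)
qed

lemma lie_gf_Suc: "fps_nth lie_gf (Suc n) = pp 1 * fps_nth lie_gf n + gsym (\<lambda>_. -1) (Suc n)"
proof -
  have nth: "fps_nth lie_gf n = (\<Sum>i=0..n. gsym (\<lambda>_. -1) i * pp 1 ^ (n - i))" for n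
    by (simp add: lie_gf_def fps_mult_nth dil_def)
  have "(\<Sum>i=0..n. gsym (\<lambda>_. -1) i * pp 1 ^ (Suc n - i)) = pp 1 * fps_nth lie_gf n"
    unfolding nth sum_distrib_left by (rule sum.cong) (simp_all add: Suc_diff_le mult_ac)
  then show ?thesis by (simp add: nth[of "Suc n"])
qed

lemma w_gf_nth: "fps_nth w_gf n = fps_nth lie_gf n + (if n \<ge> 2 then pp 2 * fps_nth lie_gf (n - 2) else 0)"
proof -
  have "dil 2 (\<lambda>k. if k = 0 then 1 else if k = 1 then pp 2 else 0) = 1 + fps_const (pp 2) * fps_X ^ 2"
  proof (rule fps_ext)
    fix n :: nat
    have "n div 2 = 0 \<and> 2 dvd n \<longleftrightarrow> n = 0" "n div 2 = 1 \<and> 2 dvd n \<longleftrightarrow> n = 2" by presburger+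
    then show "fps_nth (dil 2 (\<lambda>k. if k = 0 then 1 else if k = 1 then pp 2 else 0)) n
        = fps_nth (1 + fps_const (pp 2) * fps_X ^ 2) n"
      by (auto simp: dil_def)
  qed
  then have *: "w_gf = lie_gf + fps_const (pp 2) * lie_gf * fps_X ^ 2"
    by (simp add: w_gf_def algebra_simps)
  show ?thesis unfolding * by (simp add: fps_X_power_mult_right_nth)
qed

definition tau_symf :: "nat \<Rightarrow> symf" where
  "tau_symf n = esym n + (if n \<ge> 2 then pp 2 * esym (n - 2) else 0)"

lemma w_gf_Suc: "fps_nth w_gf (Suc n) = pp 1 * fps_nth w_gf n + cst ((-1) ^ Suc n) * tau_symf (Suc n)"
proof -
  \<comment> \<open>The term shifted by p_2 t^2 is absent in degree 1, starts in degree 2 with the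
    constant term of \<open>lie_gf\<close>, and follows the recursion of \<open>lie_gf\<close>
    afterwards.\<close>
  consider "n = 0" | "n = 1" | m where "n = Suc (Suc m)" by (metis One_nat_def not0_implies_Suc)
  then show ?thesis
  proof cases
    case 1
    then show ?thesis by (simp add: w_gf_nth lie_gf_Suc gsym_minus_one tau_symf_def)
  next
    case 2
    then show ?thesis
      by (simp add: w_gf_nth lie_gf_Suc gsym_minus_one tau_symf_def lie_gf_nth_0 numeral_2_eq_2
        algebra_simps gsym_0 esym_gsym)
  next
    case 3
    then show ?thesis
      by (simp add: w_gf_nth lie_gf_Suc gsym_minus_one tau_symf_def algebra_simps)
  qed
qed

section \<open>The virtual character \<open>\<tau>_n\<close>\<close>

abbreviation gm :: "nat \<Rightarrow> symf" where "gm \<equiv> gsym (\<lambda>_. -1)"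

text \<open>The two factors have opposite logarithmic derivatives, so that of H(t) E(-t) is 0 and n
  times its n-th coefficient vanishes.\<close>

lemma hsym_gm_convolution:
  assumes "n > 0"
  shows "(\<Sum>i=0..n. hsym i * gm (n - i)) = 0"
proof -
  have "logd (dil 1 hsym * dil 1 gm) (dillog 1 pp + dillog 1 (\<lambda>k. - pp k))"
    by (intro logd_mult logd_dil)
      (simp_all add: gsym_newton hsym_gsym[abs_def] single_uminus)
  moreover have "dillog 1 pp + dillog 1 (\<lambda>k. - pp k) = 0"
    by (rule fps_ext) (simp add: dillog_def)
  ultimately have "logd (dil 1 hsym * dil 1 gm) 0" by (simp only:)
  then have "of_nat n * fps_nth (dil 1 hsym * dil 1 gm) n = of_nat n * 0"
    by (simp add: logd_iff)
  then have "fps_nth (dil 1 hsym * dil 1 gm) n = 0"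
    by (rule of_nat_mult_cancel_symf) (rule assms)
  then show ?thesis by (simp add: fps_mult_nth dil_def)
qed

text \<open>From the third row on, the only 1 stands just left of the diagonal. Expanding along the
  last row costs a sign and deletes the next-to-last column, so columns 0 and b + 1 of the first two
  rows survive.\<close>

lemma det_shifted_rows:
  fixes A :: "'a::comm_ring_1 mat"
  assumes "A \<in> carrier_mat (b + 2) (b + 2)"
    and "\<And>i k. 2 \<le> i \<Longrightarrow> i < b + 2 \<Longrightarrow> k < b + 2 \<Longrightarrow> A $$ (i, k) = of_bool (Suc k = i)"
  shows "det A = (-1) ^ b * (A $$ (0, 0) * A $$ (1, Suc b) - A $$ (0, Suc b) * A $$ (1, 0))"
  using assms
proof (induction b arbitrary: A)
  case 0
  then have A: "A \<in> carrier_mat 2 2" by (simp add: numeral_2_eq_2)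
  have "mat_delete A i j \<in> carrier_mat 1 1" for i j
    using mat_delete_carrier[OF A] by simp
  then have d: "det (mat_delete A i j) = mat_delete A i j $$ (0, 0)" for i j
    by (rule det_single)
  have c: "cofactor A 0 0 = A $$ (1, 1)" "cofactor A 0 1 = - A $$ (1, 0)"
    unfolding cofactor_def d using A by (simp_all add: mat_delete_def)
  have "det A = A $$ (0, 0) * cofactor A 0 0 + A $$ (0, 1) * cofactor A 0 1"
    using laplace_expansion_row[OF A, of 0] by (simp add: numeral_2_eq_2)
  then show ?case unfolding c by simp
next
  case (Suc b)
  let ?n = "Suc (b + 2)"
  have A: "A \<in> carrier_mat ?n ?n" using Suc.prems(1) by simp
  define B where "B = mat_delete A (b + 2) (b + 1)"
  have B: "B \<in> carrier_mat (b + 2) (b + 2)"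
    unfolding B_def using mat_delete_carrier[OF A] by simp
  have Bij: "B $$ (i, k) = A $$ (i, if k < b + 1 then k else Suc k)" if "i < b + 2" "k < b + 2" for i k
    using that A by (simp add: B_def mat_delete_def)
  have last: "A $$ (b + 2, k) = of_bool (k = b + 1)" if "k < ?n" for k
    using Suc.prems(2)[of "b + 2" k] that by simp
  have "det A = (\<Sum>j<?n. A $$ (b + 2, j) * cofactor A (b + 2) j)"
    by (rule laplace_expansion_row[OF A]) simp
  also have "\<dots> = (\<Sum>j<?n. if j = b + 1 then cofactor A (b + 2) j else 0)"
  proof (rule sum.cong[OF refl])
    fix j assume "j \<in> {..<?n}"
    then show "A $$ (b + 2, j) * cofactor A (b + 2) j = (if j = b + 1 then cofactor A (b + 2) j else 0)"
      using last[of j] by (cases "j = b + 1") simp_all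
  qed
  also have "\<dots> = cofactor A (b + 2) (b + 1)" by simp
  also have "\<dots> = - det B" by (simp add: cofactor_def B_def power_add)
  also have "det B = (-1) ^ b * (B $$ (0, 0) * B $$ (1, Suc b) - B $$ (0, Suc b) * B $$ (1, 0))"
  proof (rule Suc.IH[OF B])
    fix i k assume ik: "2 \<le> i" "i < b + 2" "k < b + 2"
    then show "B $$ (i, k) = of_bool (Suc k = i)"
      using Suc.prems(2)[of i "if k < b + 1 then k else Suc k"] by (auto simp: Bij)
  qed
  finally show ?case by (simp add: Bij)
qed

text \<open>Column k of the Jacobi-Trudi row that starts with h_c, convolved with the coefficients
  of E(-t). Here c is the part minus its row index, hence an integer.\<close>

definition jt_conv :: "int \<Rightarrow> nat \<Rightarrow> symf" where
  "jt_conv c k = (\<Sum>j=0..k. hsym_int (c + int j) * gm (k - j))"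

text \<open>The first m terms vanish, and the rest is the whole coefficient of t^(k-m) in H(t) E(-t)
  = 1.\<close>

lemma jt_conv_nonpos:
  "jt_conv (- int m) k = of_bool (k = m)"
proof (cases "m \<le> k")
  case True
  have "jt_conv (- int m) k = (\<Sum>j\<in>(\<lambda>i. i + m) ` {0..k - m}. hsym_int (- int m + int j) * gm (k - j))"
    unfolding jt_conv_def
  proof (rule sum.mono_neutral_right)
    show "\<forall>j\<in>{0..k} - (\<lambda>i. i + m) ` {0..k - m}. hsym_int (- int m + int j) * gm (k - j) = 0"
    proof
      fix j assume j: "j \<in> {0..k} - (\<lambda>i. i + m) ` {0..k - m}"
      have "j < m"
      proof (rule ccontr)
        assume "\<not> j < m"
        then have "j = (j - m) + m" "j - m \<in> {0..k - m}" using j by auto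
        then show False using j by blast
      qed
      then show "hsym_int (- int m + int j) * gm (k - j) = 0" by (simp add: hsym_int_def)
    qed
  qed (use True in auto)
  also have "\<dots> = (\<Sum>i=0..k - m. hsym i * gm (k - m - i))"
    by (subst sum.reindex) (auto simp: inj_on_def hsym_int_def add.commute)
  also have "\<dots> = of_bool (k = m)"
  proof (cases "k = m")
    case False
    then show ?thesis using True hsym_gm_convolution[of "k - m"] by simp
  qed (simp add: hsym_gsym gsym_0)
  finally show ?thesis .
next
  case False
  then show ?thesis by (simp add: jt_conv_def hsym_int_def sum.neutral)
qed

text \<open>The sum is the tail of the coefficient of t^(k+c) in H(t) E(-t), which is 0; hence minus
  the c missing terms.\<close>

lemma jt_conv_pos:
  assumes "c > 0"
  shows "jt_conv (int c) k = - (\<Sum>i<c. hsym i * gm (k + c - i))"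
proof -
  have "0 = (\<Sum>i=0..k + c. hsym i * gm (k + c - i))"
    using hsym_gm_convolution[of "k + c"] assms by simp
  also have "{0..k + c} = {..<c} \<union> {0 + c..k + c}" by auto
  also have "(\<Sum>i\<in>{..<c} \<union> {0 + c..k + c}. hsym i * gm (k + c - i))
      = (\<Sum>i<c. hsym i * gm (k + c - i)) + (\<Sum>i=0 + c..k + c. hsym i * gm (k + c - i))"
    by (rule sum.union_disjoint) auto
  also have "(\<Sum>i=0 + c..k + c. hsym i * gm (k + c - i)) = (\<Sum>j=0..k. hsym (j + c) * gm (k - j))"
    by (subst sum.shift_bounds_cl_nat_ivl) simp
  also have "\<dots> = jt_conv (int c) k"
    unfolding jt_conv_def by (rule sum.cong) (auto simp: hsym_int_def nat_add_distrib add.commute)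
  finally show ?thesis by (simp add: eq_neg_iff_add_eq_0 add.commute)
qed

text \<open>Multiplying the Jacobi--Trudi matrix by the unitriangular matrix \<open>((-1)^(k-j) e_(k-j))\<close>
  turns the rows belonging to parts equal to \<open>1\<close> into unit vectors.\<close>
lemma schur_eq_det:
  "schur lam = det (mat (length lam) (length lam) (\<lambda>(i, k). jt_conv (int (lam ! i) - int i) k))"
proof -
  let ?L = "length lam"
  define M where "M = mat ?L ?L (\<lambda>(i, j). hsym_int (int (lam ! i) - int i + int j))"
  define U where "U = mat ?L ?L (\<lambda>(j, k). if j \<le> k then gm (k - j) else 0)"
  have M: "M \<in> carrier_mat ?L ?L" and U: "U \<in> carrier_mat ?L ?L" by (simp_all add: M_def U_def)
  have "det M = (\<Sum>p\<in>{p. p permutes {0..<?L}}. signof p * (\<Prod>i=0..<?L. M $$ (i, p i)))"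
    by (rule det_def'[OF M])
  also have "\<dots> = schur lam"
    unfolding schur_def atLeast0LessThan
  proof (rule sum.cong[OF refl])
    fix p assume "p \<in> {p. p permutes {..<?L}}"
    then have p: "p i < ?L" if "i < ?L" for i using that permutes_in_image by fastforce
    have "(\<Prod>i<?L. M $$ (i, p i)) = (\<Prod>i<?L. hsym_int (int (lam ! i) - int i + int (p i)))"
      by (rule prod.cong) (auto simp: M_def p)
    then show "signof p * (\<Prod>i<?L. M $$ (i, p i))
        = cst (of_int (sign p)) * (\<Prod>i<?L. hsym_int (int (lam ! i) - int i + int (p i)))"
      by (simp add: sign_def single_uminus)
  qed
  finally have "schur lam = det M" by simp
  also have "\<dots> = det M * det U"
  proof -
    \<comment> \<open>The diagonal entries are \<open>gm 0\<close> = 1, so multiplying by U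
      preserves the determinant.\<close>
    have "upper_triangular U" by (auto simp: U_def)
    then have "det U = (\<Prod>i=0..<?L. U $$ (i, i))"
      using det_upper_triangular[OF _ U] by (simp add: prod_list_diag_prod U_def)
    then show ?thesis by (simp add: U_def gsym_0)
  qed
  also have "\<dots> = det (M * U)" by (rule det_mult[OF M U, symmetric])
  also have "M * U = mat ?L ?L (\<lambda>(i, k). jt_conv (int (lam ! i) - int i) k)"
  proof (rule eq_matI)
    fix i k assume "i < dim_row (mat ?L ?L (\<lambda>(i, k). jt_conv (int (lam ! i) - int i) k))"
      "k < dim_col (mat ?L ?L (\<lambda>(i, k). jt_conv (int (lam ! i) - int i) k))"
    then have ik: "i < ?L" "k < ?L" by simp_all
    have "(M * U) $$ (i, k) = (\<Sum>j\<in>{0..<?L}. hsym_int (int (lam ! i) - int i + int j) * (if j \<le> k then gm (k - j) else 0))"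
      using ik by (simp add: M_def U_def scalar_prod_def)
    also have "\<dots> = jt_conv (int (lam ! i) - int i) k"
      unfolding jt_conv_def using ik by (intro sum.mono_neutral_cong_right) auto
    finally show "(M * U) $$ (i, k) = mat ?L ?L (\<lambda>(i, k). jt_conv (int (lam ! i) - int i) k) $$ (i, k)"
      using ik by simp
  qed (simp_all add: M_def U_def)
  finally show ?thesis .
qed

text \<open>A part 1 in row i >= 2 has c = -(i - 1), so its row becomes the unit vector of column i
  - 1. Leading rows (3, 1) and (2, 2) cover both shapes in tau.\<close>

lemma schur_two_rows:
  fixes xs :: "nat list"
  defines "E \<equiv> (\<lambda>i k. jt_conv (int (xs ! i) - int i) k)"
  assumes "length xs = 2"
  shows "schur (xs @ replicate b 1) = (-1) ^ b * (E 0 0 * E 1 (Suc b) - E 0 (Suc b) * E 1 0)"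
proof -
  let ?lam = "xs @ replicate b 1"
  let ?A = "mat (b + 2) (b + 2) (\<lambda>(i, k). jt_conv (int (?lam ! i) - int i) k)"
  have "schur ?lam = det ?A"
    using schur_eq_det[of ?lam] assms by (simp add: add.commute)
  also have "\<dots> = (-1) ^ b * (?A $$ (0, 0) * ?A $$ (1, Suc b) - ?A $$ (0, Suc b) * ?A $$ (1, 0))"
  proof (rule det_shifted_rows)
    fix i k assume ik: "2 \<le> i" "i < b + 2" "k < b + 2"
    then have "?lam ! i = 1" using assms by (simp add: nth_append)
    then have e: "int (?lam ! i) - int i = - int (i - 1)" using ik by simp
    have "?A $$ (i, k) = jt_conv (- int (i - 1)) k" using ik e by simp
    then show "?A $$ (i, k) = of_bool (Suc k = i)"
      using ik by (simp only: jt_conv_nonpos) auto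
  qed simp
  finally show ?thesis using assms by (simp add: nth_append)
qed

section \<open>The Schur functions in tau_n\<close>

lemma cst_minus_one_power: "cst ((-1) ^ n) = (-1) ^ n"
  by (simp add: minus_one_power_iff single_uminus)

lemma gm_esym: "gm n = (-1) ^ n * esym n"
  by (simp only: gsym_minus_one cst_minus_one_power)

text \<open>With leading rows (3, 1) the second row has c = 0 and is the unit vector of column 0, so
  only the last entry of the first row matters.\<close>

lemma schur_hook: "schur ([3] @ replicate (Suc b) 1) = esym (b + 4) - hsym 1 * esym (b + 3) + hsym 2 * esym (b + 2)"
proof -
  have "jt_conv (3 - 0) (Suc b) = - (\<Sum>i<3. hsym i * gm (Suc b + 3 - i))"
    using jt_conv_pos[of 3 "Suc b"] by simp
  also have "\<dots> = - (gm (b + 4) + hsym 1 * gm (b + 3) + hsym 2 * gm (b + 2))"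
    by (simp add: numeral_3_eq_3 numeral_2_eq_2 hsym_gsym gsym_0 eval_nat_numeral)
  finally have r0: "jt_conv 3 (Suc b) = - (gm (b + 4) + hsym 1 * gm (b + 3) + hsym 2 * gm (b + 2))" by simp
  have r1: "jt_conv 0 k = of_bool (k = 0)" for k using jt_conv_nonpos[of 0 k] by simp
  have "schur ([3] @ replicate (Suc b) 1) = schur ([3, 1] @ replicate b 1)" by simp
  also have "\<dots> = (-1) ^ b * (jt_conv 3 0 * jt_conv 0 (Suc b) - jt_conv 3 (Suc b) * jt_conv 0 0)"
    by (subst schur_two_rows) simp_all
  also have "\<dots> = (-1) ^ b * (gm (b + 4) + hsym 1 * gm (b + 3) + hsym 2 * gm (b + 2))"
    by (simp add: r0 r1 algebra_simps)
  also have "\<dots> = ((-1) ^ b * (-1) ^ b) * (esym (b + 4) - hsym 1 * esym (b + 3) + hsym 2 * esym (b + 2))"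
    by (simp add: gm_esym power_add algebra_simps)
  finally show ?thesis by (simp flip: power_mult_distrib)
qed

text \<open>This is the dual Jacobi-Trudi determinant of the conjugate partition (b + 2, 2); the
  terms with h_1 cancel.\<close>

lemma schur_two_twos:
  "schur ([2, 2] @ replicate b 1) = esym 2 * esym (b + 2) - esym 1 * esym (b + 3)"
proof -
  have r0: "jt_conv 2 k = - (gm (k + 2) + hsym 1 * gm (k + 1))" for k
    using jt_conv_pos[of 2 k] by (simp add: numeral_2_eq_2 hsym_gsym gsym_0)
  have r1: "jt_conv 1 k = - gm (k + 1)" for k
    using jt_conv_pos[of 1 k] by (simp add: hsym_gsym gsym_0)
  have "schur ([2, 2] @ replicate b 1)
      = (-1) ^ b * (jt_conv 2 0 * jt_conv 1 (Suc b) - jt_conv 2 (Suc b) * jt_conv 1 0)"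
    by (subst schur_two_rows) simp_all
  also have "\<dots> = (-1) ^ b * ((gm 2 + hsym 1 * gm 1) * gm (b + 2) - (gm (b + 3) + hsym 1 * gm (b + 2)) * gm 1)"
    by (simp add: r0 r1 numeral_3_eq_3 numeral_2_eq_2 algebra_simps)
  also have "\<dots> = ((-1) ^ b * (-1) ^ b) * (esym 2 * esym (b + 2) - esym 1 * esym (b + 3))"
    by (simp add: gm_esym power_add algebra_simps)
  finally show ?thesis by (simp flip: power_mult_distrib)
qed

text \<open>In degrees 2 and 3 these say h_n = e_n + p_2 e_(n-2), which is why tau_n is trivial
  there.\<close>

lemma hsym_esym_small:
  "hsym 1 = pp 1" "esym 1 = pp 1" "hsym 2 = esym 2 + pp 2" "hsym 3 = esym 3 + pp 2 * pp 1"
proof -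
  have H: "of_nat n * hsym n = (\<Sum>k=1..n. pp k * hsym (n - k))" for n
    using gsym_newton[of n "\<lambda>_. 1"] by (simp add: hsym_gsym)
  have E: "of_nat n * esym n = (\<Sum>k=1..n. (-1) ^ (k - 1) * pp k * esym (n - k))" for n
    using gsym_newton[of n "\<lambda>k. (-1) ^ (k - 1)"] by (simp only: esym_gsym cst_minus_one_power)
  have h0: "hsym 0 = 1" and e0: "esym 0 = 1" by (simp_all add: hsym_gsym esym_gsym gsym_0)
  show h1: "hsym 1 = pp 1" using H[of 1] h0 by simp
  show e1: "esym 1 = pp 1" using E[of 1] e0 by simp
  have "of_nat 2 * hsym 2 = of_nat 2 * (esym 2 + pp 2)"
    using H[of 2] E[of 2] h0 h1 e0 e1 by (simp add: numeral_2_eq_2 algebra_simps)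
  then show h2: "hsym 2 = esym 2 + pp 2" by (rule of_nat_mult_cancel_symf) simp
  have "of_nat 3 * hsym 3 = of_nat 3 * (esym 3 + pp 2 * pp 1)"
    using H[of 3] E[of 3] h0 h1 h2 e0 e1 by (simp add: numeral_3_eq_3 numeral_2_eq_2 algebra_simps)
  then show "hsym 3 = esym 3 + pp 2 * pp 1" by (rule of_nat_mult_cancel_symf) simp
qed

lemma chinv_tau_symf:
  assumes s: "\<sigma> \<in> Sym n" and n: "n \<ge> 1"
  shows "chinv n (tau_symf n) \<sigma> = tau n \<sigma>"
proof (cases "n \<le> 3")
  case True
  then consider "n = 1" | "n = 2" | "n = 3" using n by linarith
  then have "tau_symf n = hsym n"
    by cases (simp_all add: tau_symf_def hsym_esym_small[simplified] esym_gsym[of 0] gsym_0)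
  then show ?thesis using True by (simp add: tau_def chinv_hsym[OF s])
next
  case False
  then obtain b where b: "n = b + 4" by (metis add.commute le_add_diff_inverse not_less_eq_eq numeral_3_eq_3 eval_nat_numeral(2) semiring_norm(26-28))
  \<comment> \<open>The products of degrees 1 and n - 1 cancel because h_1 = e_1; what remains
    contains h_2 - e_2 = p_2.\<close>
  have "schur ([3] @ replicate (Suc b) 1) - schur ([2, 2] @ replicate b 1)
      = esym (b + 4) + (hsym 2 - esym 2) * esym (b + 2)"
    unfolding schur_hook schur_two_twos by (simp add: hsym_esym_small[simplified] algebra_simps)
  also have "\<dots> = tau_symf n" by (simp add: tau_symf_def b hsym_esym_small)
  finally have t: "tau_symf n = schur ([3] @ replicate (Suc b) 1) - schur ([2, 2] @ replicate b 1)" ..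
  have "n - 3 = Suc b" "n - 4 = b" "sum_list ([3] @ replicate (Suc b) 1) = n" "sum_list ([2, 2] @ replicate b 1) = n"
    using b by (simp_all add: sum_list_replicate)
  then show ?thesis
    unfolding t chinv_diff tau_def irr_char_def using False by (simp only: if_False)
qed

theorem theorem1p2:
  fixes \<zeta> :: "nat \<Rightarrow> complex"
  assumes "\<forall>n\<ge>1. primitive_root (\<zeta> n) n"
  shows "\<forall>n\<ge>1. \<forall>\<sigma>. \<sigma> permutes {..<n} \<longrightarrow>
           LieHat \<zeta> n \<sigma> = indS n (LieHat \<zeta> (n - 1)) \<sigma> + (-1) ^ n * of_int (sign \<sigma>) \<and>
           WHat \<zeta> n \<sigma> = indS n (WHat \<zeta> (n - 1)) \<sigma> + (-1) ^ n * tau n \<sigma>"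
proof (intro allI impI)
  fix n :: nat and \<sigma> :: "nat \<Rightarrow> nat"
  assume n: "1 \<le> n" and s: "\<sigma> permutes {..<n}"
  then obtain m where m: "n = Suc m" by (cases n) auto
  have sS: "\<sigma> \<in> Sym (Suc m)" using s m by (simp add: Sym_def)
  \<comment> \<open>Equality of functions is needed, as inducing evaluates the smaller character at
    conjugates of sigma.\<close>
  have L: "LieHat \<zeta> k = chinv k (fps_nth lie_gf k)" and W: "WHat \<zeta> k = chinv k (fps_nth w_gf k)" for k
    using LieHat_chinv[OF assms] WHat_chinv[OF assms] by auto
  have "LieHat \<zeta> (Suc m) \<sigma> = indS (Suc m) (LieHat \<zeta> m) \<sigma> + (-1) ^ Suc m * of_int (sign \<sigma>)"
    unfolding L lie_gf_Suc indS_chinv[OF sS] chinv_add gsym_minus_one chinv_cst_mult chinv_esym[OF sS] ..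
  moreover have "WHat \<zeta> (Suc m) \<sigma> = indS (Suc m) (WHat \<zeta> m) \<sigma> + (-1) ^ Suc m * tau (Suc m) \<sigma>"
    unfolding W w_gf_Suc indS_chinv[OF sS] chinv_add chinv_cst_mult
    by (subst chinv_tau_symf[OF sS]) simp_all
  ultimately show "LieHat \<zeta> n \<sigma> = indS n (LieHat \<zeta> (n - 1)) \<sigma> + (-1) ^ n * of_int (sign \<sigma>) \<and>
      WHat \<zeta> n \<sigma> = indS n (WHat \<zeta> (n - 1)) \<sigma> + (-1) ^ n * tau n \<sigma>"
    using m by simp
qed

end
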